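(* Let $\mathcal{R}=\mathbb{C}[\partial]A\oplus\mathbb{C}[\partial]B$ be the direct sum of two Virasoro conformal algebras, let $V_{\delta,\alpha,\beta}=\mathbb{C}[\partial]v$ be a nontrivial finite irreducible $\mathcal{R}$-module and let $\eta\in\mathbb{C}$. Consider extensions of $\mathcal{R}$-modules of the form $$0\longrightarrow \mathbb{C}c_{\eta}\longrightarrow E\longrightarrow V_{\delta,\alpha,\beta}\longrightarrow 0 .\qquad(\ast)$$ Every such $E$ is, as a vector space, $\mathbb{C}c_\eta\oplus\mathbb{C}[\partial]v$ with $\mathcal{R}_\lambda c_\eta=0$, $\partial c_\eta=\eta c_\eta$ and $$A_\lambda v=\delta_1(\partial+\alpha_1\lambda+\beta_1)v+f(\lambda)c_\eta,\qquad B_\lambda v=\delta_2(\partial+\alpha_2\lambda+\beta_2)v+g(\lambda)c_\eta \qquad(\ast\ast)$$ for some $f(\lambda),g(\lambda)\in\mathbb{C}[\lambda]$. Nontrivial extensions of the form $(\ast)$ exist only when $(\delta_1,\delta_2)=(1,0)$, $\alpha_1\in\{1,2\}$, $\beta_1+\eta=0$, or $(\delta_1,\delta_2)=(0,1)$, $\alpha_2\in\{1,2\}$, $\beta_2+\eta=0$. In these cases there exists a unique (up to a scalar) nontrivial extension, i.e. $\dim \mathrm{Ext}(V_{\delta,\alpha,\beta},\mathbb{C}c_\eta)=1$. Moreover, the nontrivial extensions are given (up to equivalence) by $(\ast\ast)$ with the following data: (i) If $\delta_1=1$, $\alpha_1\in\{1,2\}$, $\beta_1+\eta=0$, then $\delta_2=0$,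 $g(\lambda)=0$, $0\neq\alpha_2,\ \beta_2\in\mathbb{C}$ are arbitrary, and $f(\lambda)=s_1\lambda^2$ if $\alpha_1=1$, $f(\lambda)=s_2\lambda^3$ if $\alpha_1=2$, with nonzero constants $s_1,s_2$. (ii) If $\delta_2=1$, $\alpha_2\in\{1,2\}$, $\beta_2+\eta=0$, then $\delta_1=0$, $f(\lambda)=0$, $0\neq\alpha_1,\ \beta_1\in\mathbb{C}$ are arbitrary, and $g(\lambda)=t_1\lambda^2$ if $\alpha_2=1$, $g(\lambda)=t_2\lambda^3$ if $\alpha_2=2$, with nonzero constants $t_1,t_2$.
   Context: Everything is over $\mathbb{C}$. A Lie conformal algebra $\mathcal{R}$ is a $\mathbb{C}[\partial]$-module with a $\mathbb{C}$-linear $\lambda$-bracket $\mathcal{R}\otimes\mathcal{R}\to\mathcal{R}[\lambda]$, $a\otimes b\mapsto[a_\lambda b]$, satisfying $[\partial a_\lambda b]=-\lambda[a_\lambda b]$, $[a_\lambda\partial b]=(\partial+\lambda)[a_\lambda b]$, $[a_\lambda b]=-[b_{-\lambda-\partial}a]$ and $[a_\lambda[b_\mu c]]=[[a_\lambda b]_{\lambda+\mu}c]+[b_\mu[a_\lambda c]]$. A conformal $\mathcal{R}$-module $V$ is a $\mathbb{C}[\partial]$-module with a $\mathbb{C}$-linear map $\mathcal{R}\otimes V\to V[\lambda]$, $a\otimes v\mapsto a_\lambda v$, satisfying $(\partial a)_\lambda v=-\lambda(a_\lambda v)$, $a_\lambda(\partial v)=(\partial+\lambda)a_\lambda v$, $a_\lambda(b_\mu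 v)=[a_\lambda b]_{\lambda+\mu}v+b_\mu(a_\lambda v)$. For $\eta\in\mathbb{C}$, $\mathbb{C}c_\eta$ is the one-dimensional module with $\partial c_\eta=\eta c_\eta$ and $\mathcal{R}_\lambda c_\eta=0$. An extension of $W$ by $V$ is an exact sequence of modules $0\to V\to E\to W\to0$. Two extensions $E,E'$ are equivalent if there is a module homomorphism $E\to E'$ compatible with the identity maps of $V$ and $W$. An extension is trivial if it is equivalent to $V\oplus W$. $\mathrm{Ext}(W,V)$ is the vector space of extension cocycles modulo those equivalent to the trivial extension, and $\dim\mathrm{Ext}(W,V)$ is its dimension. The direct sum of two Virasoro conformal algebras has free basis $\{A,B\}$ over $\mathbb{C}[\partial]$ with $[A_\lambda A]=(\partial+2\lambda)A$, $[A_\lambda B]=0$, $[B_\lambda B]=(\partial+2\lambda)B$. Its nontrivial finite irreducible modules are $V_{\delta,\alpha,\beta}=\mathbb{C}[\partial]v$ (free of rank one) with $A_\lambda v=\delta_1(\partial+\alpha_1\lambda+\beta_1)v$, $B_\lambda v=\delta_2(\partial+\alpha_2\lambda+\beta_2)v$, where $\delta_i\in\{0,1\}$, $\delta_1^2+\delta_2^2=1$, $\beta_i\in\mathbb{C}$, $0\neq\alpha_i\in\mathbb{C}$ ($i=1,2$). *)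

theory Defs
  imports
    "HOL-Computational_Algebra.Polynomial"
    "HOL-Library.Product_Plus"
    "HOL-Library.Function_Algebras"
begin

section \<open>Modules over the polynomial ring in the derivation\<close>

text \<open>
  A \<open>\<complex>[\<partial>]\<close>-module is a complex vector space with a linear endomorphism \<open>\<partial>\<close>. The
  carrier is a whole type, so that submodules and quotients enter through homomorphisms.
\<close>

record 'v cdmod =
  smul :: "complex \<Rightarrow> 'v \<Rightarrow> 'v"
  der :: "'v \<Rightarrow> 'v"

definition cd_module :: "('v::ab_group_add, 'm) cdmod_scheme \<Rightarrow> bool" where
  "cd_module M \<longleftrightarrow>
     vector_space (smul M) \<and> Vector_Spaces.linear (smul M) (smul M) (der M)"

text \<open>\<open>pact M p m\<close> is \<open>p(\<partial>) m\<close>.\<close>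

definition pact :: "('v::ab_group_add, 'm) cdmod_scheme \<Rightarrow> complex poly \<Rightarrow> 'v \<Rightarrow> 'v" where
  "pact M p m = (\<Sum>i\<le>degree p. smul M (coeff p i) ((der M ^^ i) m))"

text \<open>
  Elements of \<open>V[\<lambda>]\<close> are polynomials with coefficients in \<open>V\<close>. Identities in \<open>V[\<lambda>]\<close> and
  \<open>V[\<lambda>,\<mu>]\<close> are stated for all values of the variables in \<open>\<complex>\<close>; as \<open>\<complex>\<close> is infinite, this is
  the same as equality of polynomials (\<open>lam_eval_inject\<close> below).
\<close>

definition lam_eval :: "(complex \<Rightarrow> 'v::ab_group_add \<Rightarrow> 'v) \<Rightarrow> 'v poly \<Rightarrow> complex \<Rightarrow> 'v" where
  "lam_eval s p x = (\<Sum>i\<le>degree p. s (x ^ i) (coeff p i))"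

lemma lam_eval_inject:
  assumes V: "vector_space s" and eq: "\<And>x. lam_eval s p x = lam_eval s q x"
  shows "p = q"
proof (rule poly_eqI)
  interpret vector_space s by (rule V)
  interpret C: vector_space "(*) :: complex \<Rightarrow> complex \<Rightarrow> complex"
    by unfold_locales (auto simp: algebra_simps)
  interpret vector_space_pair s "(*) :: complex \<Rightarrow> complex \<Rightarrow> complex" ..
  fix n
  show "coeff p n = coeff q n"
  proof (rule ccontr)
    assume ne: "coeff p n \<noteq> coeff q n"
    define u where "u = coeff p n - coeff q n"
    from ne have "independent {u}" by (simp add: u_def)
    then obtain h where h: "Vector_Spaces.linear s (*) h" and hu: "h u = (1::complex)"
      using linear_independent_extend[of "{u}" "\<lambda>_. 1"] by auto
    interpret h: Vector_Spaces.linear s "(*)" h by (rule h)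
    have ev: "h (lam_eval s r x) = poly (map_poly h r) x" for r x
    proof -
      have "poly (map_poly h r) x = (\<Sum>i\<le>degree r. coeff (map_poly h r) i * x ^ i)"
      proof -
        have "degree (map_poly h r) \<le> degree r"
          by (rule degree_le) (simp add: coeff_map_poly h.zero coeff_eq_0)
        then show ?thesis
          unfolding poly_altdef by (intro sum.mono_neutral_left) (auto simp: coeff_eq_0)
      qed
      then show ?thesis
        by (simp add: lam_eval_def h.sum h.scale coeff_map_poly h.zero mult.commute)
    qed
    have "map_poly h p = map_poly h q"
      by (rule iffD1[OF poly_eq_poly_eq_iff]) (rule ext, simp flip: ev add: eq)
    then have "coeff (map_poly h p) n = coeff (map_poly h q) n" by simp
    then have "h u = 0" by (simp add: coeff_map_poly h.zero u_def h.diff)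
    with hu show False by simp
  qed
qed

text \<open>A \<open>\<complex>\<close>-linear map \<open>U \<otimes> V \<rightarrow> W[\<lambda>]\<close>, as a bilinear map.\<close>

definition lam_bilinear ::
  "(complex \<Rightarrow> 'u::ab_group_add \<Rightarrow> 'u) \<Rightarrow> (complex \<Rightarrow> 'v::ab_group_add \<Rightarrow> 'v) \<Rightarrow>
   (complex \<Rightarrow> 'w::ab_group_add \<Rightarrow> 'w) \<Rightarrow> ('u \<Rightarrow> 'v \<Rightarrow> 'w poly) \<Rightarrow> bool" where
  "lam_bilinear sU sV sW f \<longleftrightarrow>
     (\<forall>a n. Vector_Spaces.linear sV sW (\<lambda>v. coeff (f a v) n)) \<and>
     (\<forall>v n. Vector_Spaces.linear sU sW (\<lambda>a. coeff (f a v) n))"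


section \<open>Lie conformal algebras and their modules\<close>

record (overloaded) 'r lca = "'r cdmod" +
  brk :: "'r \<Rightarrow> 'r \<Rightarrow> 'r poly"

text \<open>\<open>lbr R a x b\<close> is \<open>[a\<^sub>\<lambda> b]\<close> at \<open>\<lambda> = x\<close>.\<close>

definition lbr :: "('r::ab_group_add, 'm) lca_scheme \<Rightarrow> 'r \<Rightarrow> complex \<Rightarrow> 'r \<Rightarrow> 'r" where
  "lbr R a x b = lam_eval (smul R) (brk R a b) x"

text \<open>\<open>[b\<^bsub>-\<lambda>-\<partial>\<^esub> a]\<close>: the operator \<open>-\<lambda>-\<partial>\<close> is substituted for the variable, acting on the coefficients.\<close>

definition lbr_skew :: "('r::ab_group_add, 'm) lca_scheme \<Rightarrow> 'r \<Rightarrow> complex \<Rightarrow> 'r \<Rightarrow> 'r" where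
  "lbr_skew R b x a =
     (\<Sum>i\<le>degree (brk R b a). ((\<lambda>w. - smul R x w - der R w) ^^ i) (coeff (brk R b a) i))"

definition lie_conformal_algebra :: "('r::ab_group_add, 'm) lca_scheme \<Rightarrow> bool" where
  "lie_conformal_algebra R \<longleftrightarrow>
     cd_module R \<and>
     lam_bilinear (smul R) (smul R) (smul R) (brk R) \<and>
     (\<forall>a b x. lbr R (der R a) x b = - smul R x (lbr R a x b)) \<and>
     (\<forall>a b x. lbr R a x (der R b) = der R (lbr R a x b) + smul R x (lbr R a x b)) \<and>
     (\<forall>a b x. lbr R a x b = - lbr_skew R b x a) \<and>
     (\<forall>a b c x y.
        lbr R a x (lbr R b y c) = lbr R (lbr R a x b) (x + y) c + lbr R b y (lbr R a x c))"

record (overloaded) ('r, 'v) conf_mod = "'v cdmod" +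
  act :: "'r \<Rightarrow> 'v \<Rightarrow> 'v poly"

text \<open>\<open>lact V a x v\<close> is \<open>a\<^sub>\<lambda> v\<close> at \<open>\<lambda> = x\<close>.\<close>

definition lact :: "('r, 'v::ab_group_add) conf_mod \<Rightarrow> 'r \<Rightarrow> complex \<Rightarrow> 'v \<Rightarrow> 'v" where
  "lact V a x v = lam_eval (smul V) (act V a v) x"

definition conformal_module ::
  "('r::ab_group_add) lca \<Rightarrow> ('r, 'v::ab_group_add) conf_mod \<Rightarrow> bool" where
  "conformal_module R V \<longleftrightarrow>
     cd_module V \<and>
     lam_bilinear (smul R) (smul V) (smul V) (act V) \<and>
     (\<forall>a v x. lact V (der R a) x v = - smul V x (lact V a x v)) \<and>
     (\<forall>a v x. lact V a x (der V v) = der V (lact V a x v) + smul V x (lact V a x v)) \<and>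
     (\<forall>a b v x y.
        lact V a x (lact V b y v) = lact V (lbr R a x b) (x + y) v + lact V b y (lact V a x v))"

definition module_hom ::
  "('r, 'v::ab_group_add) conf_mod \<Rightarrow> ('r, 'w::ab_group_add) conf_mod \<Rightarrow> ('v \<Rightarrow> 'w) \<Rightarrow> bool"
where
  "module_hom V W h \<longleftrightarrow>
     Vector_Spaces.linear (smul V) (smul W) h \<and>
     (\<forall>v. h (der V v) = der W (h v)) \<and>
     (\<forall>a x v. h (lact V a x v) = lact W a x (h v))"


section \<open>Extensions\<close>

text \<open>The exact sequence \<open>0 \<rightarrow> V \<rightarrow> E \<rightarrow> W \<rightarrow> 0\<close> with maps \<open>i\<close> and \<open>p\<close>: an extension of \<open>W\<close> by \<open>V\<close>.\<close>

definition extension ::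
  "('r::ab_group_add) lca \<Rightarrow> ('r, 'v::ab_group_add) conf_mod \<Rightarrow> ('r, 'w::ab_group_add) conf_mod \<Rightarrow>
   ('r, 'e::ab_group_add) conf_mod \<Rightarrow> ('v \<Rightarrow> 'e) \<Rightarrow> ('e \<Rightarrow> 'w) \<Rightarrow> bool" where
  "extension R V W E i p \<longleftrightarrow>
     conformal_module R V \<and> conformal_module R W \<and> conformal_module R E \<and>
     module_hom V E i \<and> module_hom E W p \<and>
     inj i \<and> range i = {e. p e = 0} \<and> surj p"

definition equivalent_ext ::
  "('r, 'e::ab_group_add) conf_mod \<Rightarrow> ('v \<Rightarrow> 'e) \<Rightarrow> ('e \<Rightarrow> 'w) \<Rightarrow>
   ('r, 'f::ab_group_add) conf_mod \<Rightarrow> ('v \<Rightarrow> 'f) \<Rightarrow> ('f \<Rightarrow> 'w) \<Rightarrow> bool" where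
  "equivalent_ext E i p E' i' p' \<longleftrightarrow>
     (\<exists>h. module_hom E E' h \<and> (\<forall>v. h (i v) = i' v) \<and> (\<forall>e. p' (h e) = p e))"

definition pair_poly :: "'a::zero poly \<Rightarrow> 'b::zero poly \<Rightarrow> ('a \<times> 'b) poly" where
  "pair_poly p q = Abs_poly (\<lambda>n. (coeff p n, coeff q n))"

lemma coeff_pair_poly: "coeff (pair_poly p q) n = (coeff p n, coeff q n)"
proof -
  have "\<forall>\<^sub>\<infinity>n. (coeff p n, coeff q n) = 0"
    using MOST_coeff_eq_0[of p] MOST_coeff_eq_0[of q]
    by eventually_elim (simp add: zero_prod_def)
  then show ?thesis by (simp add: pair_poly_def Abs_poly_inverse)
qed

definition direct_sum_mod ::
  "('r, 'v::ab_group_add) conf_mod \<Rightarrow> ('r, 'w::ab_group_add) conf_mod \<Rightarrow> ('r, 'v \<times> 'w) conf_mod"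
where
  "direct_sum_mod V W =
     \<lparr> smul = (\<lambda>c (v, w). (smul V c v, smul W c w)),
       der = (\<lambda>(v, w). (der V v, der W w)),
       act = (\<lambda>a (v, w). pair_poly (act V a v) (act W a w)) \<rparr>"

definition trivial_ext ::
  "('r, 'v::ab_group_add) conf_mod \<Rightarrow> ('r, 'w::ab_group_add) conf_mod \<Rightarrow>
   ('r, 'e::ab_group_add) conf_mod \<Rightarrow> ('v \<Rightarrow> 'e) \<Rightarrow> ('e \<Rightarrow> 'w) \<Rightarrow> bool" where
  "trivial_ext V W E i p \<longleftrightarrow>
     equivalent_ext E i p (direct_sum_mod V W) (\<lambda>v. (v, 0)) snd"


section \<open>Cocycles and the space of extensions\<close>

text \<open>
  Every extension splits over \<open>\<complex>\<close>, so up to equivalence it lives on \<open>V \<oplus> W\<close>, with \<open>\<partial>\<close> and the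
  \<open>\<lambda>\<close>-action differing from those of the direct sum by maps \<open>d : W \<rightarrow> V\<close> and
  \<open>\<phi> : R \<otimes> W \<rightarrow> V[\<lambda>]\<close>. The pair \<open>(d, \<phi>)\<close> is a cocycle if the result is an \<open>R\<close>-module.
\<close>

type_synonym ('r, 'v, 'w) cochain = "('w \<Rightarrow> 'v) \<times> ('r \<Rightarrow> 'w \<Rightarrow> 'v poly)"

definition twisted_sum ::
  "('r, 'v::ab_group_add) conf_mod \<Rightarrow> ('r, 'w::ab_group_add) conf_mod \<Rightarrow>
   ('r, 'v, 'w) cochain \<Rightarrow> ('r, 'v \<times> 'w) conf_mod" where
  "twisted_sum V W z =
     \<lparr> smul = (\<lambda>c (v, w). (smul V c v, smul W c w)),
       der = (\<lambda>(v, w). (der V v + fst z w, der W w)),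
       act = (\<lambda>a (v, w). pair_poly (act V a v + snd z a w) (act W a w)) \<rparr>"

definition cocycles ::
  "('r::ab_group_add) lca \<Rightarrow> ('r, 'v::ab_group_add) conf_mod \<Rightarrow> ('r, 'w::ab_group_add) conf_mod \<Rightarrow>
   ('r, 'v, 'w) cochain set" where
  "cocycles R V W = {z. conformal_module R (twisted_sum V W z)}"

definition trivial_cocycles ::
  "('r::ab_group_add) lca \<Rightarrow> ('r, 'v::ab_group_add) conf_mod \<Rightarrow> ('r, 'w::ab_group_add) conf_mod \<Rightarrow>
   ('r, 'v, 'w) cochain set" where
  "trivial_cocycles R V W =
     {z \<in> cocycles R V W. trivial_ext V W (twisted_sum V W z) (\<lambda>v. (v, 0)) snd}"

definition cochain_scale ::
  "('r, 'v::ab_group_add) conf_mod \<Rightarrow> complex \<Rightarrow> ('r, 'v, 'w) cochain \<Rightarrow> ('r, 'v, 'w) cochain" where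
  "cochain_scale V c z = (\<lambda>w. smul V c (fst z w), \<lambda>a w. map_poly (smul V c) (snd z a w))"

text \<open>
  \<open>dim Ext(W,V) = n\<close>, where \<open>Ext(W,V)\<close> is the quotient of the space of cocycles by the subspace
  of trivial ones: there are \<open>n\<close> cocycles such that every class in the quotient is a linear
  combination of their classes with uniquely determined coefficients.
\<close>

definition ext_basis ::
  "('r::ab_group_add) lca \<Rightarrow> ('r, 'w::ab_group_add) conf_mod \<Rightarrow> ('r, 'v::ab_group_add) conf_mod \<Rightarrow>
   ('r, 'v, 'w) cochain set \<Rightarrow> bool" where
  "ext_basis R W V S \<longleftrightarrow>
     finite S \<and> S \<subseteq> cocycles R V W \<and>
     (\<forall>z\<in>cocycles R V W. \<exists>!k. (\<forall>s. s \<notin> S \<longrightarrow> k s = 0) \<and>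
        z - (\<Sum>s\<in>S. cochain_scale V (k s) s) \<in> trivial_cocycles R V W)"

definition ext_dim ::
  "('r::ab_group_add) lca \<Rightarrow> ('r, 'w::ab_group_add) conf_mod \<Rightarrow> ('r, 'v::ab_group_add) conf_mod \<Rightarrow>
   nat \<Rightarrow> bool" where
  "ext_dim R W V n \<longleftrightarrow> (\<exists>S. ext_basis R W V S \<and> card S = n)"


section \<open>The direct sum of two Virasoro conformal algebras and its modules\<close>

definition two_virasoro :: "('r::ab_group_add) lca \<Rightarrow> 'r \<Rightarrow> 'r \<Rightarrow> bool" where
  "two_virasoro R A B \<longleftrightarrow>
     lie_conformal_algebra R \<and>
     (\<forall>r. \<exists>!pq. r = pact R (fst pq) A + pact R (snd pq) B) \<and>
     (\<forall>x. lbr R A x A = der R A + smul R (2 * x) A) \<and>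
     (\<forall>x. lbr R A x B = 0) \<and>
     (\<forall>x. lbr R B x B = der R B + smul R (2 * x) B)"

definition rank_one_module ::
  "('r::ab_group_add) lca \<Rightarrow> 'r \<Rightarrow> 'r \<Rightarrow> complex \<Rightarrow> complex \<Rightarrow> complex \<Rightarrow> complex \<Rightarrow> complex \<Rightarrow> complex \<Rightarrow>
   ('r, 'v::ab_group_add) conf_mod \<Rightarrow> 'v \<Rightarrow> bool" where
  "rank_one_module R A B \<delta>1 \<delta>2 \<alpha>1 \<alpha>2 \<beta>1 \<beta>2 V v \<longleftrightarrow>
     conformal_module R V \<and>
     (\<forall>w. \<exists>!p. w = pact V p v) \<and>
     (\<forall>x. lact V A x v = smul V \<delta>1 (der V v + smul V (\<alpha>1 * x + \<beta>1) v)) \<and>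
     (\<forall>x. lact V B x v = smul V \<delta>2 (der V v + smul V (\<alpha>2 * x + \<beta>2) v))"

definition one_dim_module ::
  "('r::ab_group_add) lca \<Rightarrow> complex \<Rightarrow> ('r, 'c::ab_group_add) conf_mod \<Rightarrow> 'c \<Rightarrow> bool" where
  "one_dim_module R \<eta> C c \<longleftrightarrow>
     conformal_module R C \<and>
     (\<forall>u. \<exists>!k. u = smul C k c) \<and>
     der C c = smul C \<eta> c \<and>
     (\<forall>a x. lact C a x c = 0)"

text \<open>
  \<open>E = \<complex>c\<^sub>\<eta> \<oplus> \<complex>[\<partial>]v\<close> with the action determined by \<open>f\<close> and \<open>g\<close>. Here \<open>i c\<close> is the copy of \<open>c\<close> in
  \<open>E\<close>, and \<open>u\<close> is the lift to \<open>E\<close> of the generator \<open>v\<close> of the quotient.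
\<close>

definition standard_form ::
  "'r \<Rightarrow> 'r \<Rightarrow> complex \<Rightarrow> complex \<Rightarrow> complex \<Rightarrow> complex \<Rightarrow> complex \<Rightarrow> complex \<Rightarrow> complex \<Rightarrow>
   'c \<Rightarrow> 'v \<Rightarrow> ('r, 'e::ab_group_add) conf_mod \<Rightarrow> ('c \<Rightarrow> 'e) \<Rightarrow> ('e \<Rightarrow> 'v) \<Rightarrow>
   complex poly \<Rightarrow> complex poly \<Rightarrow> bool" where
  "standard_form A B \<delta>1 \<delta>2 \<alpha>1 \<alpha>2 \<beta>1 \<beta>2 \<eta> c v E i p f g \<longleftrightarrow>
     (\<exists>u. p u = v \<and>
        (\<forall>e. \<exists>!kq. e = smul E (fst kq) (i c) + pact E (snd kq) u) \<and>
        (\<forall>a x. lact E a x (i c) = 0) \<and>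
        der E (i c) = smul E \<eta> (i c) \<and>
        (\<forall>x. lact E A x u =
           smul E \<delta>1 (der E u + smul E (\<alpha>1 * x + \<beta>1) u) + smul E (poly f x) (i c)) \<and>
        (\<forall>x. lact E B x u =
           smul E \<delta>2 (der E u + smul E (\<alpha>2 * x + \<beta>2) u) + smul E (poly g x) (i c)))"

end

theory Submission
  imports Defs
begin

text \<open>
  Let \<open>u \<in> E\<close> be a lift of the generator \<open>v\<close>. Modulo the image of \<open>c\<close> the elements \<open>A\<close> and \<open>B\<close> act on
  \<open>u\<close> as they act on \<open>v\<close>, so the failure of \<open>u\<close> to span a copy of \<open>V\<close> is recorded by two
  polynomials \<open>f, g\<close>, the \<open>c\<close>-components of \<open>A\<^sub>\<lambda> u\<close> and \<open>B\<^sub>\<lambda> u\<close>. Since \<open>A\<close>, \<open>B\<close> generate \<open>R\<close> and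
  \<open>i c\<close>, \<open>u\<close> generate \<open>E\<close>, sesquilinearity shows that \<open>(f, g)\<close> determines \<open>E\<close> up to equivalence
  (\<open>lifts_equivalent\<close>). Any other lift is \<open>u + k c\<close>, and this changes \<open>(f, g)\<close> by
  \<open>- k (\<delta>1 (\<eta> + \<beta>1 + \<alpha>1 \<lambda>), \<delta>2 (\<eta> + \<beta>2 + \<alpha>2 \<lambda>))\<close>; hence \<open>E\<close> splits iff \<open>(f, g)\<close> is a multiple of that
  pair (\<open>trivial_iff\<close>).

  Suppose \<open>\<delta>1 = 1\<close>, \<open>\<delta>2 = 0\<close>; the other case follows by exchanging \<open>A\<close> and \<open>B\<close>. Put
  \<open>\<gamma> = \<eta> + \<beta>1\<close> and \<open>\<alpha> = \<alpha>1\<close>. The \<open>c\<close>-component of \<open>A\<^sub>\<lambda> (B\<^sub>\<mu> u) = B\<^sub>\<mu> (A\<^sub>\<lambda> u)\<close> reads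
  \<open>(\<gamma> + \<mu> + \<alpha> \<lambda>) g(\<mu>) = 0\<close>, which forces \<open>g = 0\<close> because \<open>\<alpha> \<noteq> 0\<close>, and the bracket of \<open>A\<close> with
  itself gives
  \<open>(\<gamma> + \<lambda> + \<alpha> \<mu>) f(\<lambda>) - (\<gamma> + \<mu> + \<alpha> \<lambda>) f(\<mu>) = (\<lambda> - \<mu>) f(\<lambda> + \<mu>)\<close>.
  If \<open>\<gamma> \<noteq> 0\<close>, then \<open>\<mu> = 0\<close> shows that \<open>f\<close> is a multiple of \<open>\<gamma> + \<alpha> \<lambda>\<close>, so the extension splits. If
  \<open>\<gamma> = 0\<close>, a comparison of coefficients leaves, besides the multiples of \<open>\<lambda>\<close>, only \<open>\<lambda>\<^sup>2\<close> for \<open>\<alpha> = 1\<close>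
  and \<open>\<lambda>\<^sup>3\<close> for \<open>\<alpha> = 2\<close> (\<open>cocycle_polynomial\<close>).

  Conversely every solution \<open>f\<close> of this equation comes from a module structure on \<open>C \<times> V\<close>: for
  \<open>a \<in> p(\<partial>) A + \<complex>[\<partial>] B\<close> and \<open>w = q(\<partial>) v\<close> the \<open>c\<close>-component of \<open>a\<^sub>\<lambda> w\<close> has to be
  \<open>p(-\<lambda>) q(\<eta> + \<lambda>) f(\<lambda>)\<close>, and this works (\<open>poly_cochain_cocycle\<close>). As \<open>f\<close>, for the lift \<open>(0, v)\<close>,
  depends linearly on the cocycle, \<open>Ext(V, \<complex>c)\<close> is the space of solutions modulo the multiples of
  \<open>\<gamma> + \<alpha> \<lambda>\<close>, which has dimension one for the exceptional parameters.
\<close>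

section \<open>The polynomial cocycle equation\<close>

lemma poly_ext:
  fixes p q :: "complex poly"
  assumes "\<And>x. poly p x = poly q x"
  shows "p = q"
  using assms by (simp add: fun_eq_iff flip: poly_eq_poly_eq_iff)

text \<open>
  The solutions \<open>\<gamma> + \<alpha> \<lambda>\<close> are the coboundaries. For \<open>\<gamma> = 0\<close> the equation is homogeneous: the terms
  that are linear in \<open>y\<close> confine \<open>f\<close> to the degrees \<open>1\<close> and \<open>1 + \<alpha>\<close>, those quadratic in \<open>y\<close> to degrees
  at most \<open>3\<close>.
\<close>

lemma cocycle_polynomial:
  fixes f :: "complex poly" and \<alpha> \<gamma> :: complex
  assumes \<alpha>: "\<alpha> \<noteq> 0"
    and eq: "\<And>x y. (\<gamma> + x + \<alpha> * y) * poly f x - (\<gamma> + y + \<alpha> * x) * poly f y = (x - y) * poly f (x + y)"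
  shows "\<exists>k s. f = smult k [:\<gamma>, \<alpha>:] +
    (if \<gamma> = 0 \<and> \<alpha> = 1 then monom s 2 else if \<gamma> = 0 \<and> \<alpha> = 2 then monom s 3 else 0)"
proof (cases "\<gamma> = 0")
  case False
  have "poly f x = poly (smult (poly f 0 / \<gamma>) [:\<gamma>, \<alpha>:]) x" for x
    using eq[of x 0] False by (simp add: field_simps)
  then have "f = smult (poly f 0 / \<gamma>) [:\<gamma>, \<alpha>:]"
    by (rule poly_ext)
  then have "f = smult (poly f 0 / \<gamma>) [:\<gamma>, \<alpha>:] + 0" by simp
  with False show ?thesis by (simp only: simp_thms if_False) blast
next
  case True
  have f0: "poly f 0 = 0"
    using eq[of 1 0] True \<alpha> by (simp add: algebra_simps)
  define f' f'' where "f' = pderiv f" and "f'' = pderiv f'"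
  \<comment> \<open>For fixed \<open>x\<close> both sides are polynomials in \<open>y\<close>; comparing their first and second derivatives
    at \<open>y = 0\<close> gives two linear differential equations for \<open>f\<close>.\<close>
  have eqy: "smult (poly f x) [:x, \<alpha>:] - [:\<alpha> * x, 1:] * f = [:x, -1:] * pcompose f [:x, 1:]" for x
  proof (rule poly_ext)
    fix y
    show "poly (smult (poly f x) [:x, \<alpha>:] - [:\<alpha> * x, 1:] * f) y
        = poly ([:x, -1:] * pcompose f [:x, 1:]) y"
      using eq[of x y] True by (simp add: poly_pcompose algebra_simps)
  qed
  have d1: "\<alpha> * poly f x - \<alpha> * x * poly f' 0 = x * poly f' x - poly f x" for x
    using arg_cong[OF eqy[of x], of "\<lambda>q. poly (pderiv q) 0"]
    by (simp add: pderiv_mult pderiv_diff pderiv_smult pderiv_add pderiv_minus pderiv_pCons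
        pderiv_pcompose poly_pcompose f0 f'_def algebra_simps)
  have d2: "- (\<alpha> * x * poly f'' 0) - 2 * poly f' 0 = x * poly f'' x - 2 * poly f' x" for x
    using arg_cong[OF eqy[of x], of "\<lambda>q. poly (pderiv (pderiv q)) 0"]
    by (simp add: pderiv_mult pderiv_diff pderiv_smult pderiv_add pderiv_minus pderiv_pCons
        pderiv_pcompose poly_pcompose f0 f'_def f''_def algebra_simps)
  have D1: "smult \<alpha> f - smult (\<alpha> * poly f' 0) [:0, 1:] = pCons 0 f' - f"
  proof (rule poly_ext)
    fix x
    show "poly (smult \<alpha> f - smult (\<alpha> * poly f' 0) [:0, 1:]) x = poly (pCons 0 f' - f) x"
      using d1[of x] by (simp add: algebra_simps)
  qed
  have D2: "smult (- \<alpha> * poly f'' 0) [:0, 1:] - [:2 * poly f' 0:] = pCons 0 f'' - smult 2 f'"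
  proof (rule poly_ext)
    fix x
    show "poly (smult (- \<alpha> * poly f'' 0) [:0, 1:] - [:2 * poly f' 0:]) x = poly (pCons 0 f'' - smult 2 f') x"
      using d2[of x] by (simp add: algebra_simps)
  qed
  have first: "(\<alpha> + 1 - of_nat n) * coeff f n = 0" if n: "n \<ge> 2" for n
  proof -
    obtain m where m: "n = Suc (Suc m)" using le_Suc_ex[OF n] by auto
    show ?thesis
      using arg_cong[OF D1, of "\<lambda>q. coeff q n"]
      by (simp add: m coeff_pCons f'_def coeff_pderiv algebra_simps)
  qed
  have second: "(of_nat n - 3) * coeff f n = 0" if n: "n \<ge> 4" for n
  proof -
    obtain m where m: "n = Suc (Suc (Suc (Suc m)))"
      using le_Suc_ex[OF n] by (auto simp: numeral_eq_Suc)
    have "(of_nat n - 3) * (of_nat n * coeff f n) = 0"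
      using arg_cong[OF D2, of "\<lambda>q. coeff q (n - 1)"] that
      by (simp add: m coeff_pCons f'_def f''_def coeff_pderiv algebra_simps)
    then show ?thesis using that by auto
  qed
  have high: "coeff f n = 0" if n: "n \<ge> 4" for n
  proof -
    have "(of_nat n :: complex) \<noteq> of_nat 3" using that by (subst of_nat_eq_iff) simp
    then show ?thesis using second[OF that] by simp
  qed
  have "coeff f 0 = 0" using f0 by (simp add: poly_0_coeff_0)
  have low: "f = monom (coeff f 1) 1 + monom (coeff f 2) 2 + monom (coeff f 3) 3"
  proof (rule poly_eqI)
    fix n :: nat
    consider "n = 0" | "n = 1" | "n = 2" | "n = 3" | "n \<ge> 4" by linarith
    then show "coeff f n = coeff (monom (coeff f 1) 1 + monom (coeff f 2) 2 + monom (coeff f 3) 3) n"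
      by cases (use \<open>coeff f 0 = 0\<close> high in auto)
  qed
  have "coeff f 2 = 0 \<or> \<alpha> = 1"
    using first[of 2] by (auto simp: algebra_simps)
  moreover have "coeff f 3 = 0 \<or> \<alpha> = 2"
    using first[of 3] by (auto simp: algebra_simps)
  moreover have "monom (coeff f 1) 1 = smult (coeff f 1 / \<alpha>) [:\<gamma>, \<alpha>:]"
    using True \<alpha> by (simp add: monom_altdef)
  ultimately show ?thesis
    using low True
    by (intro exI[of _ "coeff f 1 / \<alpha>"] exI[of _ "if \<alpha> = 1 then coeff f 2 else coeff f 3"]) auto
qed

section \<open>Polynomials with vector coefficients\<close>

text \<open>
  A criterion for linearity that also delivers the vector space axioms of both sides, as needed
  when the linear maps themselves are part of the hypotheses.
\<close>

lemma linear_between_iff: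
  "Vector_Spaces.linear s s' h \<longleftrightarrow>
     vector_space s \<and> vector_space s' \<and>
     (\<forall>v w. h (v + w) = h v + h w) \<and> (\<forall>k v. h (s k v) = s' k (h v))"
  unfolding Vector_Spaces.linear_def Modules.module_hom_def module_hom_axioms_def
  by (auto simp: module_iff_vector_space)

lemma lam_eval_altdef:
  assumes "vector_space s" "degree p \<le> n"
  shows "lam_eval s p x = (\<Sum>i\<le>n. s (x ^ i) (coeff p i))"
proof -
  interpret vector_space s by (rule assms)
  show ?thesis
    unfolding lam_eval_def using assms(2)
    by (intro sum.mono_neutral_left) (auto simp: coeff_eq_0)
qed

lemma lam_eval_add:
  assumes "vector_space s"
  shows "lam_eval s (p + q) x = lam_eval s p x + lam_eval s q x"
proof -
  interpret vector_space s by (rule assms)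
  define n where "n = max (degree p) (degree q)"
  have "degree (p + q) \<le> n" by (simp add: n_def degree_add_le_max)
  then show ?thesis
    by (simp add: lam_eval_altdef[OF assms, where n = n] n_def scale_right_distrib sum.distrib)
qed

text \<open>
  Evaluation uses only the vector space structure, so linear maps pass through it: scalings,
  projections, quotient maps and the embedding \<open>k \<mapsto> k c\<close> of the scalars.
\<close>

lemma lam_eval_hom:
  assumes h: "Vector_Spaces.linear s s' h" and co: "\<And>n. coeff q n = h (coeff p n)"
  shows "lam_eval s' q x = h (lam_eval s p x)"
proof -
  interpret h: Vector_Spaces.linear s s' h by (rule h)
  have "degree q \<le> degree p" by (rule degree_le) (simp add: co coeff_eq_0 h.zero)
  then have "lam_eval s' q x = (\<Sum>i\<le>degree p. s' (x ^ i) (coeff q i))"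
    by (rule lam_eval_altdef[OF h.vs2.vector_space_axioms])
  then show ?thesis by (simp add: co lam_eval_def h.sum h.scale)
qed

lemma lam_eval_linear_pCons:
  assumes "vector_space s"
  shows "lam_eval s [:a, b:] x = a + s x b"
proof -
  interpret vector_space s by (rule assms)
  show ?thesis
    by (subst lam_eval_altdef[OF assms, where n = 1]) auto
qed

lemma lam_eval_zero [simp]: "vector_space s \<Longrightarrow> lam_eval s 0 x = 0"
  by (simp add: lam_eval_def module.scale_zero_right module_iff_vector_space)

lemma lam_bilinear_eval_right:
  assumes "lam_bilinear sU sV sW f"
  shows "Vector_Spaces.linear sV sW (\<lambda>v. lam_eval sW (f a v) x)"
proof -
  have co: "Vector_Spaces.linear sV sW (\<lambda>v. coeff (f a v) n)" for n
    using assms by (simp add: lam_bilinear_def)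
  interpret W: vector_space sW using co[of 0] by (simp add: linear_between_iff)
  have sc: "Vector_Spaces.linear sW sW (sW k)" for k
    by (rule W.linear_scale_self)
  have "f a (v + w) = f a v + f a w" for v w
    using co by (intro poly_eqI) (simp add: linear_between_iff)
  moreover have "lam_eval sW (f a (sV k v)) x = sW k (lam_eval sW (f a v) x)" for k v
    using co by (intro lam_eval_hom[OF sc]) (simp add: linear_between_iff)
  ultimately show ?thesis
    using co[of 0] by (simp add: linear_between_iff lam_eval_add)
qed

lemma lam_bilinear_eval_left:
  assumes "lam_bilinear sU sV sW f"
  shows "Vector_Spaces.linear sU sW (\<lambda>a. lam_eval sW (f a v) x)"
proof -
  have "lam_bilinear sV sU sW (\<lambda>v a. f a v)"
    using assms by (simp add: lam_bilinear_def)
  then show ?thesis by (rule lam_bilinear_eval_right)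
qed

section \<open>Differential modules and conformal modules\<close>

locale cd_space =
  fixes M :: "('v::ab_group_add, 'm) cdmod_scheme"
  assumes cd: "cd_module M"
begin

sublocale vector_space "smul M"
  using cd by (simp add: cd_module_def)

sublocale der: Vector_Spaces.linear "smul M" "smul M" "der M"
  using cd by (simp add: cd_module_def)

lemma pact_altdef:
  assumes "degree p \<le> n"
  shows "pact M p m = (\<Sum>i\<le>n. smul M (coeff p i) ((der M ^^ i) m))"
  unfolding pact_def using assms
  by (intro sum.mono_neutral_left) (auto simp: coeff_eq_0)

lemma pact_0 [simp]: "pact M 0 m = 0"
  by (simp add: pact_def)

lemma pact_pCons [simp]: "pact M (pCons a p) m = smul M a m + der M (pact M p m)"
proof -
  have "pact M (pCons a p) m = (\<Sum>i\<le>Suc (degree p). smul M (coeff (pCons a p) i) ((der M ^^ i) m))"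
    by (rule pact_altdef) (rule degree_pCons_le)
  also have "\<dots> = smul M a m + (\<Sum>i\<le>degree p. der M (smul M (coeff p i) ((der M ^^ i) m)))"
    by (subst sum.atMost_Suc_shift) (simp add: der.scale)
  finally show ?thesis by (simp add: pact_def der.sum)
qed

lemma pact_1 [simp]: "pact M 1 m = m"
  by (simp add: one_pCons)

lemma pact_add: "pact M (p + q) m = pact M p m + pact M q m"
proof -
  define n where "n = max (degree p) (degree q)"
  have "degree (p + q) \<le> n" by (simp add: n_def degree_add_le_max)
  then show ?thesis
    by (simp add: pact_altdef[where n = n] n_def scale_left_distrib sum.distrib)
qed

lemma pact_smult: "pact M (smult k p) m = smul M k (pact M p m)"
  by (simp add: pact_altdef[where n = "degree p"] degree_smult_le scale_sum_right)

text \<open>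
  A property that is stable under the module operations passes from \<open>g\<close> to the whole orbit
  \<open>\<complex>[\<partial>] g\<close>; identities between sesquilinear maps are reduced to generators in this way.
\<close>

lemma pact_closed:
  assumes add: "\<And>v w. P v \<Longrightarrow> P w \<Longrightarrow> P (v + w)"
    and scale: "\<And>k v. P v \<Longrightarrow> P (smul M k v)"
    and der: "\<And>v. P v \<Longrightarrow> P (der M v)"
    and g: "P g"
  shows "P (pact M p g)"
proof (induction p)
  case 0
  show ?case using scale[OF g, of 0] by simp
next
  case (pCons a p)
  then show ?case by (simp add: add scale der g)
qed

lemma pact_linear_map:
  assumes M': "cd_space M'" and h: "Vector_Spaces.linear (smul M) (smul M') h"
    and der: "\<And>v. h (der M v) = der M' (h v)"
  shows "h (pact M p m) = pact M' p (h m)"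
proof -
  interpret M': cd_space M' by (rule M')
  interpret h: Vector_Spaces.linear "smul M" "smul M'" h by (rule h)
  show ?thesis
    by (induction p) (simp_all add: h.add h.scale der h.zero)
qed

end

locale conf_space =
  fixes R :: "('r::ab_group_add) lca" and M :: "('r, 'v::ab_group_add) conf_mod"
  assumes conf: "conformal_module R M"
begin

sublocale cd_space M
  using conf by unfold_locales (simp add: conformal_module_def)

lemma bilinear_act: "lam_bilinear (smul R) (smul M) (smul M) (act M)"
  using conf by (simp add: conformal_module_def)

sublocale lact: Vector_Spaces.linear "smul M" "smul M" "lact M a x" for a x
  unfolding lact_def by (rule lam_bilinear_eval_right[OF bilinear_act])

lemma lact_linear_left: "Vector_Spaces.linear (smul R) (smul M) (\<lambda>a. lact M a x v)"
  unfolding lact_def by (rule lam_bilinear_eval_left[OF bilinear_act])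

lemma lact_add_left: "lact M (a + b) x v = lact M a x v + lact M b x v"
  and lact_scale_left: "lact M (smul R k a) x v = smul M k (lact M a x v)"
  and lact_zero_left: "lact M 0 x v = 0"
proof -
  interpret l: Vector_Spaces.linear "smul R" "smul M" "\<lambda>a. lact M a x v"
    by (rule lact_linear_left)
  show "lact M (a + b) x v = lact M a x v + lact M b x v"
    "lact M (smul R k a) x v = smul M k (lact M a x v)" "lact M 0 x v = 0"
    by (simp_all add: l.add l.scale)
qed

lemma lact_der_left: "lact M (der R a) x v = - smul M x (lact M a x v)"
  and lact_der: "lact M a x (der M v) = der M (lact M a x v) + smul M x (lact M a x v)"
  and lact_jacobi:
    "lact M a x (lact M b y v) = lact M (lbr R a x b) (x + y) v + lact M b y (lact M a x v)"
  using conf unfolding conformal_module_def by blast+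

end

section \<open>Twisted direct sums and cocycles\<close>

locale conf_pair = V: conf_space R V + W: conf_space R W
  for R :: "('r::ab_group_add) lca"
    and V :: "('r, 'v::ab_group_add) conf_mod" and W :: "('r, 'w::ab_group_add) conf_mod"
begin

abbreviation pair_smul :: "complex \<Rightarrow> 'v \<times> 'w \<Rightarrow> 'v \<times> 'w" where
  "pair_smul \<equiv> \<lambda>k (v, w). (smul V k v, smul W k w)"

lemma pair_space: "vector_space pair_smul"
  by unfold_locales
    (auto simp: V.scale_right_distrib W.scale_right_distrib V.scale_left_distrib W.scale_left_distrib)

lemma smul_twisted [simp]: "smul (twisted_sum V W z) = pair_smul"
  and der_twisted [simp]: "der (twisted_sum V W z) (v, w) = (der V v + fst z w, der W w)"
  and act_twisted:
    "act (twisted_sum V W z) a (v, w) = pair_poly (act V a v + snd z a w) (act W a w)"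
  by (simp_all add: twisted_sum_def)

lemma lact_twisted [simp]:
  "lact (twisted_sum V W z) a x (v, w) =
     (lact V a x v + lam_eval (smul V) (snd z a w) x, lact W a x w)"
proof -
  let ?P = "act (twisted_sum V W z) a (v, w)"
  have 1: "Vector_Spaces.linear pair_smul (smul V) fst"
    and 2: "Vector_Spaces.linear pair_smul (smul W) snd"
    by (auto simp: linear_between_iff pair_space V.vector_space_axioms W.vector_space_axioms)
  have "lam_eval (smul V) (act V a v + snd z a w) x = fst (lam_eval pair_smul ?P x)"
    by (rule lam_eval_hom[OF 1]) (simp add: act_twisted coeff_pair_poly)
  moreover have "lam_eval (smul W) (act W a w) x = snd (lam_eval pair_smul ?P x)"
    by (rule lam_eval_hom[OF 2]) (simp add: act_twisted coeff_pair_poly)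
  ultimately show ?thesis
    by (simp add: lact_def lam_eval_add[OF V.vector_space_axioms] prod_eq_iff)
qed

lemma direct_sum_twisted: "direct_sum_mod V W = twisted_sum V W 0"
  by (simp add: direct_sum_mod_def twisted_sum_def zero_prod_def fun_eq_iff)

text \<open>
  With the module axioms of \<open>V\<close> and \<open>W\<close> taken for granted, the axioms for the twisted sum say
  exactly that its off-diagonal part satisfies a system of equations that is linear in \<open>z\<close>. This makes
  the cocycles a vector space. In the forward direction it suffices to look at the vectors \<open>(0, w)\<close>.
\<close>

lemma cocycle_iff:
  "z \<in> cocycles R V W \<longleftrightarrow>
     Vector_Spaces.linear (smul W) (smul V) (fst z) \<and>
     lam_bilinear (smul R) (smul W) (smul V) (snd z) \<and>
     (\<forall>a w x. lam_eval (smul V) (snd z (der R a) w) x =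
        - smul V x (lam_eval (smul V) (snd z a w) x)) \<and>
     (\<forall>a w x. lact V a x (fst z w) + lam_eval (smul V) (snd z a (der W w)) x =
        der V (lam_eval (smul V) (snd z a w) x) + fst z (lact W a x w)
          + smul V x (lam_eval (smul V) (snd z a w) x)) \<and>
     (\<forall>a b w x y.
        lact V a x (lam_eval (smul V) (snd z b w) y) + lam_eval (smul V) (snd z a (lact W b y w)) x =
        lam_eval (smul V) (snd z (lbr R a x b) w) (x + y)
          + lact V b y (lam_eval (smul V) (snd z a w) x)
          + lam_eval (smul V) (snd z b (lact W a x w)) y)"
  (is "_ \<longleftrightarrow> ?d \<and> ?b \<and> ?s \<and> ?t \<and> ?j")
proof -
  let ?E = "twisted_sum V W z"
  have R: "vector_space (smul R)"
    using V.lact_linear_left by (simp add: linear_between_iff)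
  note spaces = pair_space R V.vector_space_axioms W.vector_space_axioms
  have V_coeff: "coeff (act V a (v + v')) n = coeff (act V a v) n + coeff (act V a v') n"
    "coeff (act V a (smul V k v)) n = smul V k (coeff (act V a v) n)"
    "coeff (act V (a + a') v) n = coeff (act V a v) n + coeff (act V a' v) n"
    "coeff (act V (smul R k a) v) n = smul V k (coeff (act V a v) n)" for a a' k n v v'
    using V.bilinear_act by (simp_all add: lam_bilinear_def linear_between_iff)
  have W_coeff: "coeff (act W a (v + v')) n = coeff (act W a v) n + coeff (act W a v') n"
    "coeff (act W a (smul W k v)) n = smul W k (coeff (act W a v) n)"
    "coeff (act W (a + a') v) n = coeff (act W a v) n + coeff (act W a' v) n"
    "coeff (act W (smul R k a) v) n = smul W k (coeff (act W a v) n)" for a a' k n v v'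
    using W.bilinear_act by (simp_all add: lam_bilinear_def linear_between_iff)
  have cd: "cd_module ?E \<longleftrightarrow> ?d"
  proof
    assume "cd_module ?E"
    then have l: "Vector_Spaces.linear pair_smul pair_smul (der ?E)"
      by (simp add: cd_module_def)
    have "fst z (w + w') = fst z w + fst z w'" for w w'
    proof -
      have "der ?E ((0, w) + (0, w')) = der ?E (0, w) + der ?E (0, w')"
        using l unfolding linear_between_iff by blast
      then show ?thesis by simp
    qed
    moreover have "fst z (smul W k w) = smul V k (fst z w)" for k w
    proof -
      have "der ?E (pair_smul k (0, w)) = pair_smul k (der ?E (0, w))"
        using l unfolding linear_between_iff by blast
      then show ?thesis by simp
    qed
    ultimately show ?d by (simp add: linear_between_iff spaces)
  next
    assume ?d
    then show "cd_module ?E"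
      by (auto simp: cd_module_def linear_between_iff spaces V.der.add W.der.add V.der.scale
          W.der.scale V.scale_right_distrib)
  qed
  have bi: "lam_bilinear (smul R) (smul ?E) (smul ?E) (act ?E) \<longleftrightarrow> ?b"
  proof
    assume l: "lam_bilinear (smul R) (smul ?E) (smul ?E) (act ?E)"
    have "coeff (snd z a (w + w')) n = coeff (snd z a w) n + coeff (snd z a w') n" for a w w' n
    proof -
      have "coeff (act ?E a ((0, w) + (0, w'))) n
          = coeff (act ?E a (0, w)) n + coeff (act ?E a (0, w')) n"
        using l unfolding linear_between_iff lam_bilinear_def by blast
      then show ?thesis
        using V_coeff(1)[of a 0 0 n] by (simp add: act_twisted coeff_pair_poly)
    qed
    moreover have "coeff (snd z a (smul W k w)) n = smul V k (coeff (snd z a w) n)" for a k w n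
    proof -
      have "coeff (act ?E a (pair_smul k (0, w))) n = pair_smul k (coeff (act ?E a (0, w)) n)"
        using l unfolding smul_twisted linear_between_iff lam_bilinear_def by blast
      then show ?thesis
        using V_coeff(1)[of a 0 0 n] by (simp add: act_twisted coeff_pair_poly)
    qed
    moreover have "coeff (snd z (a + a') w) n = coeff (snd z a w) n + coeff (snd z a' w) n"
      for a a' w n
    proof -
      have "coeff (act ?E (a + a') (0, w)) n
          = coeff (act ?E a (0, w)) n + coeff (act ?E a' (0, w)) n"
        using l unfolding linear_between_iff lam_bilinear_def by blast
      then show ?thesis
        using V_coeff(1)[of _ 0 0 n] by (simp add: act_twisted coeff_pair_poly)
    qed
    moreover have "coeff (snd z (smul R k a) w) n = smul V k (coeff (snd z a w) n)" for a k w n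
    proof -
      have "coeff (act ?E (smul R k a) (0, w)) n = pair_smul k (coeff (act ?E a (0, w)) n)"
        using l unfolding smul_twisted linear_between_iff lam_bilinear_def by blast
      then show ?thesis
        using V_coeff(1)[of _ 0 0 n] by (simp add: act_twisted coeff_pair_poly)
    qed
    ultimately show ?b by (simp add: lam_bilinear_def linear_between_iff spaces)
  next
    assume ?b
    then show "lam_bilinear (smul R) (smul ?E) (smul ?E) (act ?E)"
      by (auto simp: lam_bilinear_def linear_between_iff spaces act_twisted coeff_pair_poly
          V_coeff W_coeff V.scale_right_distrib)
  qed
  have s: "(\<forall>a e x. lact ?E (der R a) x e = - smul ?E x (lact ?E a x e)) \<longleftrightarrow> ?s"
    by (auto simp: V.lact_der_left W.lact_der_left V.scale_right_distrib)
  have t: "(\<forall>a e x. lact ?E a x (der ?E e) = der ?E (lact ?E a x e) + smul ?E x (lact ?E a x e))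
      \<longleftrightarrow> ?t"
  proof
    assume l: "\<forall>a e x. lact ?E a x (der ?E e) = der ?E (lact ?E a x e) + smul ?E x (lact ?E a x e)"
    show ?t
    proof (intro allI)
      fix a w x
      show "lact V a x (fst z w) + lam_eval (smul V) (snd z a (der W w)) x =
        der V (lam_eval (smul V) (snd z a w) x) + fst z (lact W a x w)
          + smul V x (lam_eval (smul V) (snd z a w) x)"
        using l[rule_format, of a x "(0, w)"] by simp
    qed
  next
    assume t: ?t
    show "\<forall>a e x. lact ?E a x (der ?E e) = der ?E (lact ?E a x e) + smul ?E x (lact ?E a x e)"
    proof (intro allI)
      fix a x and e :: "'v \<times> 'w"
      obtain v w where e: "e = (v, w)" by (cases e)
      show "lact ?E a x (der ?E e) = der ?E (lact ?E a x e) + smul ?E x (lact ?E a x e)"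
        using t[rule_format, of a x w]
        by (simp add: e V.lact.add V.der.add V.lact_der W.lact_der V.scale_right_distrib algebra_simps)
    qed
  qed
  have j: "(\<forall>a b e x y. lact ?E a x (lact ?E b y e)
        = lact ?E (lbr R a x b) (x + y) e + lact ?E b y (lact ?E a x e)) \<longleftrightarrow> ?j"
  proof
    assume l: "\<forall>a b e x y. lact ?E a x (lact ?E b y e)
        = lact ?E (lbr R a x b) (x + y) e + lact ?E b y (lact ?E a x e)"
    show ?j
    proof (intro allI)
      fix a b w x y
      show "lact V a x (lam_eval (smul V) (snd z b w) y)
          + lam_eval (smul V) (snd z a (lact W b y w)) x =
        lam_eval (smul V) (snd z (lbr R a x b) w) (x + y)
          + lact V b y (lam_eval (smul V) (snd z a w) x)
          + lam_eval (smul V) (snd z b (lact W a x w)) y"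
        using l[rule_format, of a x b y "(0, w)"] by (simp add: algebra_simps)
    qed
  next
    assume j: ?j
    show "\<forall>a b e x y. lact ?E a x (lact ?E b y e)
        = lact ?E (lbr R a x b) (x + y) e + lact ?E b y (lact ?E a x e)"
    proof (intro allI)
      fix a b x y and e :: "'v \<times> 'w"
      obtain v w where e: "e = (v, w)" by (cases e)
      have 1: "lact V a x (lact V b y v)
          = lact V (lbr R a x b) (x + y) v + lact V b y (lact V a x v)"
        by (rule V.lact_jacobi)
      have 2: "lact W a x (lact W b y w)
          = lact W (lbr R a x b) (x + y) w + lact W b y (lact W a x w)"
        by (rule W.lact_jacobi)
      show "lact ?E a x (lact ?E b y e)
          = lact ?E (lbr R a x b) (x + y) e + lact ?E b y (lact ?E a x e)"
        unfolding e using j[rule_format, of a x b w y] 1 2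
        by (simp add: V.lact.add add_ac)
    qed
  qed
  show ?thesis
    unfolding cocycles_def mem_Collect_eq conformal_module_def cd bi s t j ..
qed

lemma twisted_extension:
  assumes "z \<in> cocycles R V W"
  shows "extension R V W (twisted_sum V W z) (\<lambda>v. (v, 0)) snd"
proof -
  have lin: "Vector_Spaces.linear (smul W) (smul V) (fst z)"
    and bil: "lam_bilinear (smul R) (smul W) (smul V) (snd z)"
    using assms by (auto simp: cocycle_iff)
  interpret d: Vector_Spaces.linear "smul W" "smul V" "fst z" by (rule lin)
  interpret f: Vector_Spaces.linear "smul W" "smul V" "\<lambda>w. lam_eval (smul V) (snd z a w) x" for a x
    by (rule lam_bilinear_eval_right[OF bil])
  have "conformal_module R (twisted_sum V W z)"
    using assms by (simp add: cocycles_def)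
  moreover have "module_hom V (twisted_sum V W z) (\<lambda>v. (v, 0))"
    by (auto simp: module_hom_def linear_between_iff pair_space V.vector_space_axioms)
  moreover have "module_hom (twisted_sum V W z) W snd"
    by (auto simp: module_hom_def linear_between_iff pair_space W.vector_space_axioms)
  ultimately show ?thesis
    by (auto simp: extension_def V.conf W.conf inj_def image_iff surj_def)
qed

lemma zero_cocycle: "0 \<in> cocycles R V W"
proof -
  have "vector_space (smul R)"
    using V.lact_linear_left by (simp add: linear_between_iff)
  then show ?thesis
    by (simp add: cocycle_iff zero_prod_def zero_fun_def lam_bilinear_def linear_between_iff
        V.vector_space_axioms W.vector_space_axioms)
qed

lemma cochain_scale_simps:
  "fst (cochain_scale V k z) w = smul V k (fst z w)"
  "lam_eval (smul V) (snd (cochain_scale V k z) a w) x = smul V k (lam_eval (smul V) (snd z a w) x)"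
  "coeff (snd (cochain_scale V k z) a w) n = smul V k (coeff (snd z a w) n)"
proof -
  show co: "coeff (snd (cochain_scale V k z) a w) n = smul V k (coeff (snd z a w) n)" for n
    by (simp add: cochain_scale_def coeff_map_poly)
  show "lam_eval (smul V) (snd (cochain_scale V k z) a w) x
      = smul V k (lam_eval (smul V) (snd z a w) x)"
    by (rule lam_eval_hom[OF V.linear_scale_self co])
qed (simp add: cochain_scale_def)

lemma lam_eval_diff: "lam_eval (smul V) (p - q) x = lam_eval (smul V) p x - lam_eval (smul V) q x"
  using lam_eval_add[OF V.vector_space_axioms, of "p - q" q x] by simp

text \<open>
  Each condition in \<open>cocycle_iff\<close> for the combination is that condition for \<open>z\<close> minus \<open>k\<close> times that
  condition for \<open>z'\<close>.
\<close>

lemma cocycle_diff_scale: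
  assumes z: "z \<in> cocycles R V W" and z': "z' \<in> cocycles R V W"
  shows "z - cochain_scale V k z' \<in> cocycles R V W"
proof -
  have lin: "Vector_Spaces.linear (smul W) (smul V) (fst z)"
    and bil: "lam_bilinear (smul R) (smul W) (smul V) (snd z)"
    and lin': "Vector_Spaces.linear (smul W) (smul V) (fst z')"
    and bil': "lam_bilinear (smul R) (smul W) (smul V) (snd z')"
    using assms by (auto simp: cocycle_iff)
  note s = cochain_scale_simps
  have "Vector_Spaces.linear (smul W) (smul V) (fst (z - cochain_scale V k z'))"
    using lin lin' by (simp add: linear_between_iff s V.scale_right_distrib V.scale_right_diff_distrib
        V.scale_left_commute)
  moreover have "lam_bilinear (smul R) (smul W) (smul V) (snd (z - cochain_scale V k z'))"
    using bil bil' by (simp add: lam_bilinear_def linear_between_iff s V.scale_right_distrib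
        V.scale_right_diff_distrib V.scale_left_commute)
  moreover have "lam_eval (smul V) (snd z (der R a) w) x
        = - smul V x (lam_eval (smul V) (snd z a w) x)"
    "lact V a x (fst z w) + lam_eval (smul V) (snd z a (der W w)) x =
        der V (lam_eval (smul V) (snd z a w) x) + fst z (lact W a x w)
          + smul V x (lam_eval (smul V) (snd z a w) x)"
    "lact V a x (lam_eval (smul V) (snd z b w) y) + lam_eval (smul V) (snd z a (lact W b y w)) x =
        lam_eval (smul V) (snd z (lbr R a x b) w) (x + y)
          + lact V b y (lam_eval (smul V) (snd z a w) x)
          + lam_eval (smul V) (snd z b (lact W a x w)) y"
    if "z \<in> cocycles R V W" for z a b w x y
    using that by (simp_all add: cocycle_iff)
  note eqs = this[OF z] this[OF z']
  have "lact V a x (fst z w - smul V k (fst z' w))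
      + (lam_eval (smul V) (snd z a (der W w)) x - smul V k (lam_eval (smul V) (snd z' a (der W w)) x)) =
     der V (lam_eval (smul V) (snd z a w) x - smul V k (lam_eval (smul V) (snd z' a w) x))
       + (fst z (lact W a x w) - smul V k (fst z' (lact W a x w)))
       + smul V x (lam_eval (smul V) (snd z a w) x - smul V k (lam_eval (smul V) (snd z' a w) x))"
    (is "?l = ?r") for a w x
  proof -
    have "?l = (lact V a x (fst z w) + lam_eval (smul V) (snd z a (der W w)) x)
        - smul V k (lact V a x (fst z' w) + lam_eval (smul V) (snd z' a (der W w)) x)"
      by (simp add: V.lact.diff V.lact.scale V.scale_right_distrib algebra_simps)
    also have "\<dots> = ?r"
      unfolding eqs
      by (simp add: V.der.diff V.der.scale V.scale_right_distrib V.scale_right_diff_distrib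
          V.scale_left_commute algebra_simps)
    finally show ?thesis .
  qed
  moreover have
    "lact V a x (lam_eval (smul V) (snd z b w) y - smul V k (lam_eval (smul V) (snd z' b w) y))
      + (lam_eval (smul V) (snd z a (lact W b y w)) x
          - smul V k (lam_eval (smul V) (snd z' a (lact W b y w)) x)) =
     lam_eval (smul V) (snd z (lbr R a x b) w) (x + y)
       - smul V k (lam_eval (smul V) (snd z' (lbr R a x b) w) (x + y))
       + lact V b y (lam_eval (smul V) (snd z a w) x - smul V k (lam_eval (smul V) (snd z' a w) x))
       + (lam_eval (smul V) (snd z b (lact W a x w)) y
          - smul V k (lam_eval (smul V) (snd z' b (lact W a x w)) y))"
    (is "?l = ?r") for a b w x y
  proof -
    have "?l = (lact V a x (lam_eval (smul V) (snd z b w) y)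
          + lam_eval (smul V) (snd z a (lact W b y w)) x)
        - smul V k (lact V a x (lam_eval (smul V) (snd z' b w) y)
          + lam_eval (smul V) (snd z' a (lact W b y w)) x)"
      by (simp add: V.lact.diff V.lact.scale V.scale_right_distrib algebra_simps)
    also have "\<dots> = ?r"
      unfolding eqs by (simp add: V.lact.diff V.lact.scale V.scale_right_distrib algebra_simps)
    finally show ?thesis .
  qed
  ultimately show ?thesis
    using eqs(1,4)
    by (simp add: cocycle_iff lam_eval_diff s V.scale_right_diff_distrib V.scale_left_commute)
qed

end

section \<open>Extensions of a rank one module by a one-dimensional module\<close>

locale virasoro_pair =
  fixes R :: "('r::ab_group_add) lca" and A B :: 'r
    and V :: "('r, 'v::ab_group_add) conf_mod" and v :: 'v
    and C :: "('r, 'c::ab_group_add) conf_mod" and c :: 'c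
    and \<delta>1 \<delta>2 \<alpha>1 \<alpha>2 \<beta>1 \<beta>2 \<eta> :: complex
  assumes virasoro: "two_virasoro R A B"
    and rank_one: "rank_one_module R A B \<delta>1 \<delta>2 \<alpha>1 \<alpha>2 \<beta>1 \<beta>2 V v"
    and one_dim: "one_dim_module R \<eta> C c"
begin

sublocale C: conf_space R C
  using one_dim by unfold_locales (simp add: one_dim_module_def)

sublocale V: conf_space R V
  using rank_one by unfold_locales (simp add: rank_one_module_def)

sublocale R: cd_space R
  using virasoro by unfold_locales (simp add: two_virasoro_def lie_conformal_algebra_def)

sublocale pair: conf_pair R C V
  by unfold_locales

lemma C_span: "\<exists>!k. u = smul C k c"
  and der_c: "der C c = smul C \<eta> c"
  using one_dim by (simp_all add: one_dim_module_def)

lemma lact_C [simp]: "lact C a x u = 0"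
proof -
  obtain k where "u = smul C k c" using C_span by blast
  moreover have "lact C a x c = 0" using one_dim by (simp add: one_dim_module_def)
  ultimately show ?thesis by (simp add: C.lact.scale)
qed

lemma der_C: "der C u = smul C \<eta> u"
proof -
  obtain k where "u = smul C k c" using C_span by blast
  then show ?thesis by (simp add: C.der.scale der_c C.scale_left_commute)
qed

lemma smul_c_eq_iff: "smul C k c = smul C k' c \<longleftrightarrow> k = k'"
  using C_span[of "smul C k c"] by blast

lemma smul_c_eq_0_iff: "smul C k c = 0 \<longleftrightarrow> k = 0"
  using smul_c_eq_iff[of k 0] by simp

lemma V_span: "\<exists>!p. w = pact V p v"
  and lact_A_v: "lact V A x v = smul V \<delta>1 (der V v + smul V (\<alpha>1 * x + \<beta>1) v)"
  and lact_B_v: "lact V B x v = smul V \<delta>2 (der V v + smul V (\<alpha>2 * x + \<beta>2) v)"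
  using rank_one by (simp_all add: rank_one_module_def)

lemma V_induct:
  assumes "\<And>w w'. P w \<Longrightarrow> P w' \<Longrightarrow> P (w + w')" "\<And>k w. P w \<Longrightarrow> P (smul V k w)"
    "\<And>w. P w \<Longrightarrow> P (der V w)" "P v"
  shows "P w"
proof -
  obtain p where "w = pact V p v" using V_span by blast
  then show ?thesis using V.pact_closed[of P, OF assms] by simp
qed

lemma R_span: "\<exists>!pq. a = pact R (fst pq) A + pact R (snd pq) B"
  and lbr_A_A: "lbr R A x A = der R A + smul R (2 * x) A"
  and lbr_A_B: "lbr R A x B = 0"
  and lbr_B_B: "lbr R B x B = der R B + smul R (2 * x) B"
  using virasoro by (simp_all add: two_virasoro_def)

lemma lie: "lie_conformal_algebra R"
  using virasoro by (simp add: two_virasoro_def)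

lemma bilinear_brk: "lam_bilinear (smul R) (smul R) (smul R) (brk R)"
  using lie by (simp add: lie_conformal_algebra_def)

sublocale lbr: Vector_Spaces.linear "smul R" "smul R" "lbr R a x" for a x
  unfolding lbr_def by (rule lam_bilinear_eval_right[OF bilinear_brk])

lemma lbr_linear_left: "Vector_Spaces.linear (smul R) (smul R) (\<lambda>a. lbr R a x b)"
  unfolding lbr_def by (rule lam_bilinear_eval_left[OF bilinear_brk])

lemma lbr_der_left: "lbr R (der R a) x b = - smul R x (lbr R a x b)"
  and lbr_der: "lbr R a x (der R b) = der R (lbr R a x b) + smul R x (lbr R a x b)"
  and lbr_skew: "lbr R a x b = - lbr_skew R b x a"
  using lie unfolding lie_conformal_algebra_def by blast+

text \<open>
  Skew-symmetry substitutes an operator for \<open>\<lambda>\<close>, so the vanishing of the values \<open>[A\<^sub>\<lambda> B]\<close> has to be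
  turned into the vanishing of the polynomial first.
\<close>

lemma lbr_B_A: "lbr R B x A = 0"
proof -
  have "brk R A B = 0"
  proof (rule lam_eval_inject[OF R.vector_space_axioms])
    show "lam_eval (smul R) (brk R A B) y = lam_eval (smul R) 0 y" for y
      using lbr_A_B[of y] by (simp add: lbr_def lam_eval_zero[OF R.vector_space_axioms])
  qed
  then show ?thesis by (simp add: lbr_skew[of B] lbr_skew_def)
qed

lemma R_induct:
  assumes add: "\<And>a b. P a \<Longrightarrow> P b \<Longrightarrow> P (a + b)" and "\<And>k a. P a \<Longrightarrow> P (smul R k a)"
    "\<And>a. P a \<Longrightarrow> P (der R a)" and A: "P A" and B: "P B"
  shows "P a"
proof -
  obtain p q where "a = pact R p A + pact R q B" using R_span by (metis prod.collapse)
  then show ?thesis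
    using add[OF R.pact_closed[of P, OF assms(1-3) A] R.pact_closed[of P, OF assms(1-3) B]]
    by simp
qed

text \<open>
  The existential witness in \<open>standard_form\<close>, made explicit: different lifts of \<open>v\<close> in the same
  extension have to be compared.
\<close>

definition lift_with ::
  "('r, 'e::ab_group_add) conf_mod \<Rightarrow> ('c \<Rightarrow> 'e) \<Rightarrow> ('e \<Rightarrow> 'v) \<Rightarrow> 'e \<Rightarrow>
   complex poly \<Rightarrow> complex poly \<Rightarrow> bool" where
  "lift_with E i p u f g \<longleftrightarrow> p u = v \<and>
     (\<forall>x. lact E A x u =
        smul E \<delta>1 (der E u + smul E (\<alpha>1 * x + \<beta>1) u) + smul E (poly f x) (i c)) \<and>
     (\<forall>x. lact E B x u =
        smul E \<delta>2 (der E u + smul E (\<alpha>2 * x + \<beta>2) u) + smul E (poly g x) (i c))"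

end

locale virasoro_extension = virasoro_pair R A B V v C c \<delta>1 \<delta>2 \<alpha>1 \<alpha>2 \<beta>1 \<beta>2 \<eta>
  for R :: "('r::ab_group_add) lca" and A B :: 'r
    and V :: "('r, 'v::ab_group_add) conf_mod" and v :: 'v
    and C :: "('r, 'c::ab_group_add) conf_mod" and c :: 'c
    and \<delta>1 \<delta>2 \<alpha>1 \<alpha>2 \<beta>1 \<beta>2 \<eta> :: complex +
  fixes E :: "('r, 'e::ab_group_add) conf_mod" and i :: "'c \<Rightarrow> 'e" and p :: "'e \<Rightarrow> 'v"
  assumes ext: "extension R C V E i p"
begin

sublocale E: conf_space R E
  using ext by unfold_locales (simp add: extension_def)

sublocale i: Vector_Spaces.linear "smul C" "smul E" i
  using ext by (simp add: extension_def module_hom_def)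

sublocale p: Vector_Spaces.linear "smul E" "smul V" p
  using ext by (simp add: extension_def module_hom_def)

lemma der_i: "der E (i u) = smul E \<eta> (i u)"
  using ext by (simp add: extension_def module_hom_def flip: i.scale der_C)

lemma lact_i [simp]: "lact E a x (i u) = 0"
proof -
  have "lact E a x (i u) = i (lact C a x u)"
    using ext by (simp add: extension_def module_hom_def)
  then show ?thesis by simp
qed

lemma p_der: "p (der E e) = der V (p e)"
  and p_lact: "p (lact E a x e) = lact V a x (p e)"
  using ext by (simp_all add: extension_def module_hom_def)

lemma p_i [simp]: "p (i u) = 0"
  using ext by (auto simp: extension_def)

lemma kernel:
  assumes "p e = 0"
  shows "\<exists>!k. e = smul E k (i c)"
proof -
  have "e \<in> range i" using ext assms by (simp add: extension_def)
  then obtain u where "e = i u" by blast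
  moreover have "inj i" using ext by (simp add: extension_def)
  ultimately show ?thesis using C_span[of u] by (simp add: inj_eq flip: i.scale)
qed

lemma smul_ic_eq_iff: "smul E k (i c) = smul E k' (i c) \<longleftrightarrow> k = k'"
  using kernel[of "smul E k (i c)"] by (auto simp: p.scale)

lemma p_pact: "p (pact E q u) = pact V q (p u)"
  by (rule E.pact_linear_map[OF V.cd_space_axioms p.linear_axioms p_der])

text \<open>
  As a module over \<open>\<complex>[\<partial>]\<close> the quotient \<open>V\<close> is free, so \<open>E\<close> splits over \<open>\<complex>[\<partial>]\<close>: any lift of the
  generator spans a complement of the line \<open>\<complex> c\<close>.
\<close>

lemma E_span:
  assumes u: "p u = v"
  shows "\<exists>!kq. e = smul E (fst kq) (i c) + pact E (snd kq) u"
proof -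
  obtain q where q: "p e = pact V q v" using V_span by blast
  then have "p (e - pact E q u) = 0" by (simp add: p.diff p_pact u)
  then obtain k where "e - pact E q u = smul E k (i c)" using kernel by blast
  then have ex: "e = smul E k (i c) + pact E q u" by (simp add: algebra_simps)
  show ?thesis
  proof (rule ex1I[of _ "(k, q)"])
    show "e = smul E (fst (k, q)) (i c) + pact E (snd (k, q)) u" using ex by simp
    fix kq assume kq: "e = smul E (fst kq) (i c) + pact E (snd kq) u"
    then have "p e = pact V (snd kq) v" by (simp add: p.add p.scale p_pact u)
    with q have "snd kq = q" using V_span by metis
    moreover from this have "smul E (fst kq) (i c) = smul E k (i c)"
      using kq ex by (metis add_right_cancel)
    then have "fst kq = k" by (simp only: smul_ic_eq_iff)
    ultimately show "kq = (k, q)" by (simp add: prod_eq_iff)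
  qed
qed

lemma E_induct:
  assumes u: "p u = v"
    and add: "\<And>w w'. P w \<Longrightarrow> P w' \<Longrightarrow> P (w + w')" and scale: "\<And>k w. P w \<Longrightarrow> P (smul E k w)"
    and der: "\<And>w. P w \<Longrightarrow> P (der E w)" and gen: "P (i c)" "P u"
  shows "P e"
proof -
  obtain k q where "e = smul E k (i c) + pact E q u" using E_span[OF u] by (metis prod.collapse)
  then show ?thesis
    using add[OF scale[OF gen(1)] E.pact_closed[of P, OF add scale der gen(2)]] by simp
qed

lemma standard_form_iff:
  "standard_form A B \<delta>1 \<delta>2 \<alpha>1 \<alpha>2 \<beta>1 \<beta>2 \<eta> c v E i p f g \<longleftrightarrow> (\<exists>u. lift_with E i p u f g)"
proof
  assume "\<exists>u. lift_with E i p u f g"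
  then obtain u where u: "lift_with E i p u f g" ..
  then have "p u = v" by (simp add: lift_with_def)
  with u show "standard_form A B \<delta>1 \<delta>2 \<alpha>1 \<alpha>2 \<beta>1 \<beta>2 \<eta> c v E i p f g"
    unfolding standard_form_def lift_with_def
    by (intro exI[of _ u] conjI allI E_span der_i lact_i) auto
qed (auto simp: standard_form_def lift_with_def)

lemma lact_modulo_c:
  assumes "\<And>x. lact V a x (p w) = p e + smul V x (p e')"
  shows "\<exists>f. \<forall>x. lact E a x w = e + smul E x e' + smul E (poly f x) (i c)"
proof -
  \<comment> \<open>The difference is a polynomial over \<open>E\<close> that is killed by \<open>p\<close>, hence has its coefficients in the line
    \<open>\<complex> c\<close>. Working with coefficients rather than values makes the coordinate a polynomial in \<open>\<lambda>\<close>.\<close>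
  define D where "D = act E a w - [:e, e':]"
  have D: "lam_eval (smul E) D x = lact E a x w - (e + smul E x e')" for x
  proof -
    have "lact E a x w = lam_eval (smul E) (D + [:e, e':]) x"
      by (simp add: D_def lact_def)
    also have "\<dots> = lam_eval (smul E) D x + (e + smul E x e')"
      by (simp add: lam_eval_add lam_eval_linear_pCons E.vector_space_axioms)
    finally show ?thesis by simp
  qed
  have "map_poly p D = 0"
  proof (rule lam_eval_inject[OF V.vector_space_axioms])
    fix x
    have "lam_eval (smul V) (map_poly p D) x = p (lam_eval (smul E) D x)"
      by (rule lam_eval_hom[OF p.linear_axioms]) (simp add: coeff_map_poly)
    also have "\<dots> = 0" using assms[of x] by (simp add: D p.diff p.add p.scale p_lact)
    finally show "lam_eval (smul V) (map_poly p D) x = lam_eval (smul V) 0 x"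
      by (simp add: lam_eval_zero V.vector_space_axioms)
  qed
  then have pD: "p (coeff D n) = 0" for n
    by (metis coeff_0 coeff_map_poly p.zero)
  define \<kappa> where "\<kappa> e = (THE k. e = smul E k (i c))" for e
  have \<kappa>: "e = smul E (\<kappa> e) (i c)" if "p e = 0" for e
    unfolding \<kappa>_def using theI'[OF kernel[OF that]] .
  have "\<kappa> 0 = 0"
    using \<kappa>[of 0] smul_ic_eq_iff[of "\<kappa> 0" 0] by simp
  then have co: "coeff D n = smul E (coeff (map_poly \<kappa> D) n) (i c)" for n
    using \<kappa>[OF pD] by (simp add: coeff_map_poly)
  have "lam_eval (smul E) D x = smul E (poly (map_poly \<kappa> D) x) (i c)" for x
  proof -
    have "vector_space ((*) :: complex \<Rightarrow> complex \<Rightarrow> complex)"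
      by unfold_locales (auto simp: algebra_simps)
    then have "Vector_Spaces.linear (*) (smul E) (\<lambda>k. smul E k (i c))"
      by (simp add: linear_between_iff E.vector_space_axioms E.scale_left_distrib)
    then have "lam_eval (smul E) D x = smul E (lam_eval (*) (map_poly \<kappa> D) x) (i c)"
      by (rule lam_eval_hom) (rule co)
    also have "lam_eval (*) (map_poly \<kappa> D) x = poly (map_poly \<kappa> D) x"
      by (simp add: lam_eval_def poly_altdef mult.commute)
    finally show ?thesis .
  qed
  then show ?thesis
    unfolding D by (intro exI[of _ "map_poly \<kappa> D"]) (simp add: algebra_simps)
qed

lemma generator_lifts: "\<exists>u. p u = v"
  using ext by (metis extension_def surjD)

lemma lift_exists:
  assumes u: "p u = v"
  shows "\<exists>f g. lift_with E i p u f g"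
proof -
  have split: "smul E \<delta> (der E u + smul E (\<alpha> * x + \<beta>) u)
      = smul E \<delta> (der E u + smul E \<beta> u) + smul E x (smul E (\<delta> * \<alpha>) u)" for \<delta> \<alpha> \<beta> x
    by (simp add: E.scale_right_distrib E.scale_left_distrib algebra_simps)
  have split': "smul V \<delta> (der V v + smul V (\<alpha> * x + \<beta>) v)
      = p (smul E \<delta> (der E u + smul E \<beta> u)) + smul V x (p (smul E (\<delta> * \<alpha>) u))" for \<delta> \<alpha> \<beta> x
    by (simp add: u p.add p.scale p_der V.scale_right_distrib V.scale_left_distrib algebra_simps)
  obtain f where "\<forall>x. lact E A x u = smul E \<delta>1 (der E u + smul E \<beta>1 u)
      + smul E x (smul E (\<delta>1 * \<alpha>1) u) + smul E (poly f x) (i c)"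
    using lact_modulo_c[of A u] unfolding u lact_A_v split' by blast
  moreover obtain g where "\<forall>x. lact E B x u = smul E \<delta>2 (der E u + smul E \<beta>2 u)
      + smul E x (smul E (\<delta>2 * \<alpha>2) u) + smul E (poly g x) (i c)"
    using lact_modulo_c[of B u] unfolding u lact_B_v split' by blast
  ultimately have "lift_with E i p u f g" by (simp add: lift_with_def u split)
  then show ?thesis by blast
qed

text \<open>
  The coboundaries: on \<open>c\<close> the operator \<open>\<partial> + \<alpha> \<lambda> + \<beta>\<close> is multiplication by \<open>\<eta> + \<beta> + \<alpha> \<lambda>\<close>, while
  \<open>R\<close> acts on \<open>c\<close> by zero.
\<close>

lemma lift_shift:
  assumes "lift_with E i p u f g"
  shows "lift_with E i p (u + smul E k (i c))
     (f - smult k (smult \<delta>1 [:\<eta> + \<beta>1, \<alpha>1:])) (g - smult k (smult \<delta>2 [:\<eta> + \<beta>2, \<alpha>2:]))"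
proof -
  have "smul E \<delta> (der E u + smul E (\<alpha> * x + \<beta>) u) + smul E (poly h x) (i c) =
     smul E \<delta> (der E (u + smul E k (i c)) + smul E (\<alpha> * x + \<beta>) (u + smul E k (i c)))
       + smul E (poly (h - smult k (smult \<delta> [:\<eta> + \<beta>, \<alpha>:])) x) (i c)" (is "?l = ?r") for \<delta> \<alpha> \<beta> h x
  proof -
    have "?r = smul E \<delta> (der E u + smul E (\<alpha> * x + \<beta>) u)
        + smul E (\<delta> * (k * \<eta>) + \<delta> * ((\<alpha> * x + \<beta>) * k)
            + (poly h x - k * (\<delta> * (\<eta> + \<beta> + x * \<alpha>)))) (i c)"
      by (simp add: E.der.add E.der.scale der_i E.scale_right_distrib E.scale_left_distrib
          algebra_simps)
    also have "\<delta> * (k * \<eta>) + \<delta> * ((\<alpha> * x + \<beta>) * k) + (poly h x - k * (\<delta> * (\<eta> + \<beta> + x * \<alpha>)))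
        = poly h x"
      by (simp add: algebra_simps)
    finally show ?thesis ..
  qed
  then show ?thesis
    using assms unfolding lift_with_def
    by (simp only: E.lact.add E.lact.scale lact_i p.add p.scale p_i) simp
qed

text \<open>
  The coordinates serve twice: \<open>\<kappa>\<close> extracts the \<open>c\<close>-component of an identity in \<open>E\<close>, and both
  together define maps out of \<open>E\<close>.
\<close>

lemma lift_coordinates:
  assumes u: "p u = v"
  obtains \<kappa> :: "'e \<Rightarrow> complex" and Q :: "'e \<Rightarrow> complex poly"
  where "\<And>e. e = smul E (\<kappa> e) (i c) + pact E (Q e) u"
    and "\<And>k q. \<kappa> (smul E k (i c) + pact E q u) = k"
    and "\<And>k q. Q (smul E k (i c) + pact E q u) = q"
    and "\<And>e e'. \<kappa> (e + e') = \<kappa> e + \<kappa> e'" and "\<And>e e'. Q (e + e') = Q e + Q e'"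
    and "\<And>k e. \<kappa> (smul E k e) = k * \<kappa> e" and "\<And>k e. Q (smul E k e) = smult k (Q e)"
    and "\<And>e. \<kappa> (der E e) = \<eta> * \<kappa> e" and "\<And>e. Q (der E e) = pCons 0 (Q e)"
proof -
  obtain F where F: "\<And>e. e = smul E (fst (F e)) (i c) + pact E (snd (F e)) u"
    using E_span[OF u] by metis
  define \<kappa> Q where "\<kappa> = fst \<circ> F" and "Q = snd \<circ> F"
  have dec: "e = smul E (\<kappa> e) (i c) + pact E (Q e) u" for e
    using F by (simp add: \<kappa>_def Q_def)
  have unique: "\<kappa> e = k \<and> Q e = q" if "e = smul E k (i c) + pact E q u" for e k q
  proof -
    have "F e = (k, q)"
      using E_span[OF u, of e] F[of e] that by (metis fst_conv snd_conv)
    then show ?thesis by (simp add: \<kappa>_def Q_def)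
  qed
  have "e + e' = smul E (\<kappa> e + \<kappa> e') (i c) + pact E (Q e + Q e') u" for e e'
    by (subst (1) dec[of e], subst (1) dec[of e'])
      (simp add: E.pact_add E.scale_left_distrib add_ac)
  moreover have "smul E k e = smul E (k * \<kappa> e) (i c) + pact E (smult k (Q e)) u" for k e
    by (subst (1) dec[of e]) (simp add: E.pact_smult E.scale_right_distrib)
  moreover have "der E e = smul E (\<eta> * \<kappa> e) (i c) + pact E (pCons 0 (Q e)) u" for e
    by (subst (1) dec[of e]) (simp add: E.der.add E.der.scale der_i mult.commute)
  ultimately show thesis
    using that[of \<kappa> Q] dec unique by blast
qed

end

section \<open>Cocycle equations, equivalence and triviality\<close>

context virasoro_extension
begin

text \<open>
  Both equations are the \<open>c\<close>-components of instances of the Jacobi identity applied to \<open>u\<close>, for the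
  pairs \<open>A, A\<close> and \<open>A, B\<close>. The coordinate \<open>\<kappa>\<close> turns \<open>\<partial>\<close> into multiplication by \<open>\<eta>\<close>, and hence
  \<open>a\<^sub>\<lambda> \<circ> \<partial>\<close> into multiplication by \<open>\<eta> + \<lambda>\<close>.
\<close>

lemma lift_cocycle_equations:
  assumes lift: "lift_with E i p u f g"
  shows "\<delta>1 * ((\<eta> + \<beta>1 + x + \<alpha>1 * y) * poly f x - (\<eta> + \<beta>1 + y + \<alpha>1 * x) * poly f y)
      = (x - y) * poly f (x + y)"
    and "\<delta>2 * (\<eta> + \<beta>2 + x + \<alpha>2 * y) * poly f x = \<delta>1 * (\<eta> + \<beta>1 + y + \<alpha>1 * x) * poly g y"
proof -
  have u: "p u = v"
    and Au: "\<And>x. lact E A x u = smul E \<delta>1 (der E u + smul E (\<alpha>1 * x + \<beta>1) u) + smul E (poly f x) (i c)"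
    and Bu: "\<And>x. lact E B x u = smul E \<delta>2 (der E u + smul E (\<alpha>2 * x + \<beta>2) u) + smul E (poly g x) (i c)"
    using lift by (simp_all add: lift_with_def)
  obtain \<kappa> :: "'e \<Rightarrow> complex" where \<kappa>: "\<And>k q. \<kappa> (smul E k (i c) + pact E q u) = k"
    "\<And>e e'. \<kappa> (e + e') = \<kappa> e + \<kappa> e'" "\<And>k e. \<kappa> (smul E k e) = k * \<kappa> e"
    "\<And>e. \<kappa> (der E e) = \<eta> * \<kappa> e"
    by (rule lift_coordinates[OF u]) blast
  have "\<kappa> u = 0" using \<kappa>(1)[of 0 1] by simp
  have "\<kappa> (i c) = 1" using \<kappa>(1)[of 1 0] by simp
  have "\<kappa> 0 = 0" using \<kappa>(1)[of 0 0] by simp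
  have \<kappa>A: "\<kappa> (lact E A x u) = poly f x" and \<kappa>B: "\<kappa> (lact E B x u) = poly g x" for x
    by (simp_all add: Au Bu \<kappa> \<open>\<kappa> u = 0\<close> \<open>\<kappa> (i c) = 1\<close>)
  have \<kappa>2: "\<kappa> (lact E a x (smul E \<delta> (der E u + smul E s u) + smul E t (i c)))
      = \<delta> * (\<eta> + x + s) * \<kappa> (lact E a x u)" for a x \<delta> s t
    by (simp add: E.lact.add E.lact.scale E.lact_der \<kappa> \<open>\<kappa> 0 = 0\<close> algebra_simps)
  have "\<kappa> (lact E (lbr R A x A) (x + y) u) = (x - y) * poly f (x + y)"
  proof -
    have "lact E (lbr R A x A) (x + y) u = smul E (x - y) (lact E A (x + y) u)"
      by (simp add: lbr_A_A E.lact_add_left E.lact_der_left E.lact_scale_left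
          flip: E.scale_minus_left E.scale_left_distrib)
    then show ?thesis by (simp only: \<kappa> \<kappa>A)
  qed
  moreover have "\<kappa> (lact E A x (lact E A y u))
      = \<kappa> (lact E (lbr R A x A) (x + y) u) + \<kappa> (lact E A y (lact E A x u))"
    by (simp only: E.lact_jacobi[of A x A y u] \<kappa>)
  moreover have "\<kappa> (lact E A x (lact E A y u)) = \<delta>1 * (\<eta> + x + (\<alpha>1 * y + \<beta>1)) * poly f x" for x y
    by (simp only: Au[of y] \<kappa>2 \<kappa>A)
  ultimately show "\<delta>1 * ((\<eta> + \<beta>1 + x + \<alpha>1 * y) * poly f x - (\<eta> + \<beta>1 + y + \<alpha>1 * x) * poly f y)
      = (x - y) * poly f (x + y)"
    by (simp add: algebra_simps)
  have "\<kappa> (lact E A x (lact E B y u)) = \<kappa> (lact E B y (lact E A x u))"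
    by (simp add: E.lact_jacobi[of A x B y u] lbr_A_B E.lact_zero_left)
  moreover have "\<kappa> (lact E A x (lact E B y u)) = \<delta>2 * (\<eta> + x + (\<alpha>2 * y + \<beta>2)) * poly f x"
    "\<kappa> (lact E B y (lact E A x u)) = \<delta>1 * (\<eta> + y + (\<alpha>1 * x + \<beta>1)) * poly g y"
    by (simp_all only: Bu[of y] \<kappa>2 \<kappa>A, simp_all only: Au[of x] \<kappa>2 \<kappa>B)
  ultimately show "\<delta>2 * (\<eta> + \<beta>2 + x + \<alpha>2 * y) * poly f x = \<delta>1 * (\<eta> + \<beta>1 + y + \<alpha>1 * x) * poly g y"
    by (simp add: algebra_simps)
qed

end

context virasoro_pair
begin

text \<open>
  The map that sends \<open>i c\<close> to \<open>i' c\<close> and \<open>u\<close> to \<open>u'\<close> and commutes with \<open>\<partial>\<close> respects the action of \<open>A\<close>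
  and \<open>B\<close> on these two generators by hypothesis, and therefore everywhere by sesquilinearity.
\<close>

lemma lifts_equivalent:
  assumes ext: "extension R C V E i p" and lift: "lift_with E i p u f g"
    and ext': "extension R C V E' i' p'" and lift': "lift_with E' i' p' u' f g"
  shows "equivalent_ext E i p E' i' p'"
proof -
  interpret E: virasoro_extension R A B V v C c \<delta>1 \<delta>2 \<alpha>1 \<alpha>2 \<beta>1 \<beta>2 \<eta> E i p
    by unfold_locales (rule ext)
  interpret E': virasoro_extension R A B V v C c \<delta>1 \<delta>2 \<alpha>1 \<alpha>2 \<beta>1 \<beta>2 \<eta> E' i' p'
    by unfold_locales (rule ext')
  have u: "p u = v" and u': "p' u' = v" using lift lift' by (simp_all add: lift_with_def)
  obtain \<kappa> Q where dec: "\<And>e. e = smul E (\<kappa> e) (i c) + pact E (Q e) u"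
    and \<kappa>0: "\<And>k q. \<kappa> (smul E k (i c) + pact E q u) = k"
    and Q0: "\<And>k q. Q (smul E k (i c) + pact E q u) = q"
    and laws: "\<And>e e'. \<kappa> (e + e') = \<kappa> e + \<kappa> e'" "\<And>e e'. Q (e + e') = Q e + Q e'"
      "\<And>k e. \<kappa> (smul E k e) = k * \<kappa> e" "\<And>k e. Q (smul E k e) = smult k (Q e)"
      "\<And>e. \<kappa> (der E e) = \<eta> * \<kappa> e" "\<And>e. Q (der E e) = pCons 0 (Q e)"
    by (rule E.lift_coordinates[OF u]) blast
  define h where "h e = smul E' (\<kappa> e) (i' c) + pact E' (Q e) u'" for e
  have h_gen: "h (smul E k (i c) + pact E q u) = smul E' k (i' c) + pact E' q u'" for k q
    by (simp add: h_def \<kappa>0 Q0)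
  have h_ic: "h (i c) = i' c" using h_gen[of 1 0] by simp
  have h_u: "h u = u'" using h_gen[of 0 1] by simp
  have h_lin: "Vector_Spaces.linear (smul E) (smul E') h"
    by (simp add: linear_between_iff E.E.vector_space_axioms E'.E.vector_space_axioms h_def laws
        E'.E.pact_add E'.E.pact_smult E'.E.scale_left_distrib E'.E.scale_right_distrib)
  interpret h: Vector_Spaces.linear "smul E" "smul E'" h by (rule h_lin)
  have h_der: "h (der E e) = der E' (h e)" for e
    by (simp add: h_def laws E'.E.der.add E'.E.der.scale E'.der_i mult.commute)
  have sesqui: "\<forall>x. h (lact E a x e) = lact E' a x (h e)"
    if hu: "\<And>x. h (lact E a x u) = lact E' a x (h u)" for a e
    by (rule E.E_induct[OF u])
      (simp_all add: h_ic h.zero hu E.E.lact.add E'.E.lact.add E.E.lact.scale E'.E.lact.scale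
        E.E.lact_der E'.E.lact_der h.add h.scale h_der)
  have "\<forall>x e. h (lact E a x e) = lact E' a x (h e)" for a
  proof (rule R_induct)
    show "\<forall>x e. h (lact E A x e) = lact E' A x (h e)"
      using sesqui[of A] lift lift' by (simp add: lift_with_def h.add h.scale h_der h_u h_ic h.zero)
    show "\<forall>x e. h (lact E B x e) = lact E' B x (h e)"
      using sesqui[of B] lift lift' by (simp add: lift_with_def h.add h.scale h_der h_u h_ic h.zero)
  qed (simp_all add: E.E.lact_add_left E'.E.lact_add_left E.E.lact_scale_left E'.E.lact_scale_left
      E.E.lact_der_left E'.E.lact_der_left h.add h.scale h.neg)
  then have "module_hom E E' h"
    using h_lin h_der by (simp add: module_hom_def)
  moreover have "h (i w) = i' w" for w
  proof -
    obtain k where "w = smul C k c" using C_span by blast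
    then show ?thesis by (simp add: E.i.scale E'.i.scale h.scale h_ic)
  qed
  moreover have "p' (h e) = p e" for e
  proof -
    have "p e = pact V (Q e) v"
      by (subst dec[of e]) (simp add: E.p.add E.p.scale E.p_pact u)
    then show ?thesis by (simp add: h_def E'.p.add E'.p.scale E'.p_pact u')
  qed
  ultimately show ?thesis unfolding equivalent_ext_def by blast
qed

lemma lift_twisted_iff:
  assumes "z \<in> cocycles R C V"
  shows "lift_with (twisted_sum C V z) (\<lambda>u. (u, 0)) snd (0, v) f g \<longleftrightarrow>
    (\<forall>x. lam_eval (smul C) (snd z A v) x = smul C \<delta>1 (fst z v) + smul C (poly f x) c) \<and>
    (\<forall>x. lam_eval (smul C) (snd z B v) x = smul C \<delta>2 (fst z v) + smul C (poly g x) c)"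
  by (simp add: lift_with_def lact_A_v lact_B_v)

text \<open>
  The direct sum has the lift \<open>(0, v)\<close> with polynomials \<open>0, 0\<close>. If the pair \<open>(f, g)\<close> is a coboundary,
  a shift of \<open>u\<close> produces the same polynomials in \<open>E\<close>. Conversely a splitting sends \<open>u\<close> to \<open>(k c, v)\<close>
  for some \<open>k\<close>, and the \<open>c\<close>-components of \<open>A\<^sub>\<lambda> u\<close>, \<open>B\<^sub>\<lambda> u\<close> under the splitting vanish.
\<close>

lemma trivial_iff:
  assumes ext: "extension R C V E i p" and lift: "lift_with E i p u f g"
  shows "trivial_ext C V E i p \<longleftrightarrow>
    (\<exists>k. f = smult k (smult \<delta>1 [:\<eta> + \<beta>1, \<alpha>1:]) \<and> g = smult k (smult \<delta>2 [:\<eta> + \<beta>2, \<alpha>2:]))"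
proof
  interpret virasoro_extension R A B V v C c \<delta>1 \<delta>2 \<alpha>1 \<alpha>2 \<beta>1 \<beta>2 \<eta> E i p
    by unfold_locales (rule ext)
  {
    assume "\<exists>k. f = smult k (smult \<delta>1 [:\<eta> + \<beta>1, \<alpha>1:]) \<and> g = smult k (smult \<delta>2 [:\<eta> + \<beta>2, \<alpha>2:])"
    then obtain k where k: "lift_with E i p (u + smul E k (i c)) 0 0"
      using lift_shift[OF lift] by (metis diff_self)
    have "lift_with (twisted_sum C V 0) (\<lambda>u. (u, 0)) snd (0, v) 0 0"
      unfolding lift_twisted_iff[OF pair.zero_cocycle]
      by (simp add: lam_eval_zero C.vector_space_axioms)
    from lifts_equivalent[OF ext k pair.twisted_extension[OF pair.zero_cocycle] this]
    show "trivial_ext C V E i p" by (simp add: trivial_ext_def pair.direct_sum_twisted)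
  }
  assume "trivial_ext C V E i p"
  then obtain h where h: "module_hom E (twisted_sum C V 0) h"
    and hi: "\<And>w. h (i w) = (w, 0)" and ph: "\<And>e. snd (h e) = p e"
    by (auto simp: trivial_ext_def equivalent_ext_def pair.direct_sum_twisted)
  then interpret h: Vector_Spaces.linear "smul E" pair.pair_smul h
    by (simp add: module_hom_def)
  obtain k where k: "fst (h u) = smul C k c" using C_span by blast
  have hu: "h u = (smul C k c, v)"
    using k ph[of u] lift by (simp add: prod_eq_iff lift_with_def)
  have h_der: "h (der E e) = der (twisted_sum C V 0) (h e)"
    and h_lact: "h (lact E a x e) = lact (twisted_sum C V 0) a x (h e)" for a x e
    using h by (simp_all add: module_hom_def)
  have eq: "poly q x = poly (smult (- k) (smult \<delta> [:\<eta> + \<beta>, \<alpha>:])) x"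
    if "lact E a x u = smul E \<delta> (der E u + smul E (\<alpha> * x + \<beta>) u) + smul E (poly q x) (i c)"
    for a x \<delta> \<alpha> \<beta> q
  proof -
    have "h (lact E a x u) = (0, lact V a x v)"
      by (simp add: h_lact hu lam_eval_zero[OF C.vector_space_axioms])
    also have "h (lact E a x u)
        = (smul C (\<delta> * (\<eta> * k + (\<alpha> * x + \<beta>) * k) + poly q x) c,
            smul V \<delta> (der V v + smul V (\<alpha> * x + \<beta>) v))"
      by (simp add: that h.add h.scale h_der hu hi der_C C.scale_right_distrib C.scale_left_distrib
          algebra_simps)
    finally have "\<delta> * (\<eta> * k + (\<alpha> * x + \<beta>) * k) + poly q x = 0"
      by (simp add: smul_c_eq_0_iff del: C.scale_eq_0_iff)
    then have "poly q x = - (\<delta> * (\<eta> * k + (\<alpha> * x + \<beta>) * k))" by (simp only: add_eq_0_iff)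
    then show ?thesis by (simp add: algebra_simps)
  qed
  have "f = smult (- k) (smult \<delta>1 [:\<eta> + \<beta>1, \<alpha>1:])"
    by (rule poly_ext, rule eq[of A]) (use lift in \<open>simp add: lift_with_def\<close>)
  moreover have "g = smult (- k) (smult \<delta>2 [:\<eta> + \<beta>2, \<alpha>2:])"
    by (rule poly_ext, rule eq[of B]) (use lift in \<open>simp add: lift_with_def\<close>)
  ultimately show "\<exists>k. f = smult k (smult \<delta>1 [:\<eta> + \<beta>1, \<alpha>1:]) \<and> g = smult k (smult \<delta>2 [:\<eta> + \<beta>2, \<alpha>2:])"
    by blast
qed

end

section \<open>The case where only the first Virasoro algebra acts\<close>

locale virasoro_first = virasoro_pair R A B V v C c \<delta>1 \<delta>2 \<alpha>1 \<alpha>2 \<beta>1 \<beta>2 \<eta>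
  for R :: "('r::ab_group_add) lca" and A B :: 'r
    and V :: "('r, 'v::ab_group_add) conf_mod" and v :: 'v
    and C :: "('r, 'c::ab_group_add) conf_mod" and c :: 'c
    and \<delta>1 \<delta>2 \<alpha>1 \<alpha>2 \<beta>1 \<beta>2 \<eta> :: complex +
  assumes \<delta>: "\<delta>1 = 1" "\<delta>2 = 0" and \<alpha>1: "\<alpha>1 \<noteq> 0"
begin

text \<open>
  The mixed equation reads \<open>0 = (\<eta> + \<beta>1 + y + \<alpha>1 x) g(y)\<close>; as \<open>\<alpha>1 \<noteq> 0\<close>, some \<open>x\<close> makes the first
  factor equal to \<open>1\<close>, so that \<open>g(y) = 0\<close>.
\<close>

lemma lift_classification:
  assumes ext: "extension R C V E i p" and lift: "lift_with E i p u f g"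
  shows "g = 0 \<and> (\<exists>k s. f = smult k [:\<eta> + \<beta>1, \<alpha>1:] +
    (if \<eta> + \<beta>1 = 0 \<and> \<alpha>1 = 1 then monom s 2
     else if \<eta> + \<beta>1 = 0 \<and> \<alpha>1 = 2 then monom s 3 else 0))"
proof
  interpret virasoro_extension R A B V v C c \<delta>1 \<delta>2 \<alpha>1 \<alpha>2 \<beta>1 \<beta>2 \<eta> E i p
    by unfold_locales (rule ext)
  show "g = 0"
  proof (rule poly_ext)
    fix y
    show "poly g y = poly 0 y"
      using lift_cocycle_equations(2)[OF lift, of "(1 - \<eta> - \<beta>1 - y) / \<alpha>1" y] \<alpha>1
      by (simp add: \<delta>)
  qed
  show "\<exists>k s. f = smult k [:\<eta> + \<beta>1, \<alpha>1:] +
    (if \<eta> + \<beta>1 = 0 \<and> \<alpha>1 = 1 then monom s 2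
     else if \<eta> + \<beta>1 = 0 \<and> \<alpha>1 = 2 then monom s 3 else 0)"
    by (rule cocycle_polynomial[OF \<alpha>1]) (use lift_cocycle_equations(1)[OF lift] in \<open>simp add: \<delta>\<close>)
qed

lemma nontrivial_parameters:
  assumes ext: "extension R C V E i p" and nontriv: "\<not> trivial_ext C V E i p"
  shows "\<alpha>1 \<in> {1, 2} \<and> \<eta> + \<beta>1 = 0"
proof (rule ccontr)
  assume *: "\<not> ?thesis"
  interpret virasoro_extension R A B V v C c \<delta>1 \<delta>2 \<alpha>1 \<alpha>2 \<beta>1 \<beta>2 \<eta> E i p
    by unfold_locales (rule ext)
  obtain u where "p u = v" using generator_lifts by blast
  then obtain f g where lift: "lift_with E i p u f g" using lift_exists by blast
  from lift_classification[OF ext lift] * have "g = 0" "\<exists>k. f = smult k [:\<eta> + \<beta>1, \<alpha>1:]"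
    by auto
  then show False using nontriv by (simp add: trivial_iff[OF ext lift] \<delta>)
qed

definition A_coord :: "'r \<Rightarrow> complex poly" where
  "A_coord a = fst (THE pq. a = pact R (fst pq) A + pact R (snd pq) B)"

definition v_coord :: "'v \<Rightarrow> complex poly" where
  "v_coord w = (THE q. w = pact V q v)"

lemma A_coord_unique: "A_coord (pact R q A + pact R q' B) = q"
proof -
  have "(THE pq. pact R q A + pact R q' B = pact R (fst pq) A + pact R (snd pq) B) = (q, q')"
    by (rule the1_equality[OF R_span]) simp
  then show ?thesis by (simp add: A_coord_def)
qed

lemma v_coord_unique: "v_coord (pact V q v) = q"
  unfolding v_coord_def by (rule the1_equality[OF V_span]) simp

lemma A_coord_simps:
  "A_coord (a + b) = A_coord a + A_coord b" "A_coord (smul R k a) = smult k (A_coord a)"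
  "A_coord (der R a) = pCons 0 (A_coord a)" "A_coord A = 1" "A_coord B = 0" "A_coord 0 = 0"
proof -
  obtain q q' r r' where a: "a = pact R q A + pact R q' B" and b: "b = pact R r A + pact R r' B"
    using R_span by (metis prod.collapse)
  have "a + b = pact R (q + r) A + pact R (q' + r') B"
    by (simp add: a b R.pact_add)
  then show "A_coord (a + b) = A_coord a + A_coord b" by (simp only: A_coord_unique a b)
  have "smul R k a = pact R (smult k q) A + pact R (smult k q') B"
    by (simp add: a R.pact_smult R.scale_right_distrib)
  then show "A_coord (smul R k a) = smult k (A_coord a)" by (simp only: A_coord_unique a)
  have "der R a = pact R (pCons 0 q) A + pact R (pCons 0 q') B"
    by (simp add: a R.der.add)
  then show "A_coord (der R a) = pCons 0 (A_coord a)" by (simp only: A_coord_unique a)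
  show "A_coord A = 1" "A_coord B = 0" "A_coord 0 = 0"
    using A_coord_unique[of 1 0] A_coord_unique[of 0 1] A_coord_unique[of 0 0] by simp_all
qed

lemma v_coord_simps:
  "v_coord (w + w') = v_coord w + v_coord w'" "v_coord (smul V k w) = smult k (v_coord w)"
  "v_coord (der V w) = pCons 0 (v_coord w)" "v_coord v = 1" "v_coord 0 = 0"
proof -
  obtain q r where w: "w = pact V q v" "w' = pact V r v" using V_span by metis
  have "w + w' = pact V (q + r) v" "smul V k w = pact V (smult k q) v"
    "der V w = pact V (pCons 0 q) v"
    by (simp_all add: w V.pact_add V.pact_smult)
  then show "v_coord (w + w') = v_coord w + v_coord w'" "v_coord (smul V k w) = smult k (v_coord w)"
    "v_coord (der V w) = pCons 0 (v_coord w)"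
    by (simp_all only: v_coord_unique w)
  show "v_coord v = 1" "v_coord 0 = 0"
    using v_coord_unique[of 1] v_coord_unique[of 0] by simp_all
qed

text \<open>
  Evaluated coordinates turn the action and the bracket into scalar formulas: \<open>\<partial>\<close> in the first
  argument becomes the evaluation of its coordinate at \<open>- y\<close>, and moving \<open>\<partial>\<close> past \<open>b\<^sub>y\<close> shifts the
  argument of the coordinate of \<open>w\<close> by \<open>y\<close>.
\<close>

lemma v_coord_lact:
  "poly (v_coord (lact V b y w)) t =
     poly (A_coord b) (- y) * poly (v_coord w) (t + y) * (t + \<alpha>1 * y + \<beta>1)"
proof -
  have A: "\<forall>t y. poly (v_coord (lact V A y w)) t = poly (v_coord w) (t + y) * (t + \<alpha>1 * y + \<beta>1)" for w
    by (rule V_induct)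
      (simp_all add: V.lact.add V.lact.scale V.lact_der lact_A_v v_coord_simps \<delta> algebra_simps)
  have B: "\<forall>t y. poly (v_coord (lact V B y w)) t = 0" for w
    by (rule V_induct)
      (simp_all add: V.lact.add V.lact.scale V.lact_der lact_B_v v_coord_simps \<delta>)
  have neg: "v_coord (- w) = - v_coord w" for w
    using v_coord_simps(2)[of "- 1" w] by simp
  have "\<forall>w t y. poly (v_coord (lact V b y w)) t =
     poly (A_coord b) (- y) * poly (v_coord w) (t + y) * (t + \<alpha>1 * y + \<beta>1)"
    by (rule R_induct)
      (simp_all add: A B A_coord_simps v_coord_simps neg V.lact_add_left V.lact_scale_left
        V.lact_der_left algebra_simps)
  then show ?thesis by blast
qed

lemma A_coord_lbr:
  "poly (A_coord (lbr R a x b)) (- (x + y)) = poly (A_coord a) (- x) * poly (A_coord b) (- y) * (x - y)"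
proof -
  have neg: "A_coord (- a) = - A_coord a" for a
    using A_coord_simps(2)[of "- 1" a] by simp
  \<comment> \<open>The induction runs over the statement in the variable \<open>z = - (x + y)\<close>, so that the left-hand side is a
    plain evaluation.\<close>
  have gen: "\<forall>x z. poly (A_coord (lbr R a x b)) z =
      poly (A_coord a) (- x) * poly (A_coord b) (z + x) * (2 * x + z)"
    if a: "a = A \<or> a = B" for a b
  proof (induct b rule: R_induct)
    show "\<forall>x z. poly (A_coord (lbr R a x A)) z =
      poly (A_coord a) (- x) * poly (A_coord A) (z + x) * (2 * x + z)"
      using a by (auto simp: lbr_A_A lbr_B_A A_coord_simps)
    show "\<forall>x z. poly (A_coord (lbr R a x B)) z =
      poly (A_coord a) (- x) * poly (A_coord B) (z + x) * (2 * x + z)"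
      using a by (auto simp: lbr_A_B lbr_B_B A_coord_simps)
  qed (simp_all add: lbr.add lbr.scale lbr_der A_coord_simps algebra_simps)
  interpret l: Vector_Spaces.linear "smul R" "smul R" "\<lambda>a. lbr R a x b" for x b
    by (rule lbr_linear_left)
  have "\<forall>x z b. poly (A_coord (lbr R a x b)) z =
      poly (A_coord a) (- x) * poly (A_coord b) (z + x) * (2 * x + z)"
    by (induct a rule: R_induct)
      (simp_all add: gen l.add l.scale lbr_der_left A_coord_simps neg algebra_simps)
  then show ?thesis by simp
qed

text \<open>
  The only cochain with vanishing \<open>\<partial>\<close>-part that is compatible with \<open>\<partial>\<close> in both arguments and sends
  \<open>(A, v)\<close> to \<open>f(\<lambda>) c\<close> and \<open>(B, v)\<close> to \<open>0\<close>: the operator \<open>\<partial>\<close> is replaced by \<open>- \<lambda>\<close> in the first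
  argument and by \<open>\<eta> + \<lambda>\<close> in the second one.
\<close>

definition poly_cochain :: "complex poly \<Rightarrow> ('r, 'c, 'v) cochain" where
  "poly_cochain f = (\<lambda>w. 0, \<lambda>a w. map_poly (\<lambda>k. smul C k c)
     (pcompose (A_coord a) [:0, -1:] * pcompose (v_coord w) [:\<eta>, 1:] * f))"

lemma eval_poly_cochain:
  "lam_eval (smul C) (snd (poly_cochain f) a w) x =
     smul C (poly (A_coord a) (- x) * poly (v_coord w) (\<eta> + x) * poly f x) c"
proof -
  let ?P = "pcompose (A_coord a) [:0, -1:] * pcompose (v_coord w) [:\<eta>, 1:] * f"
  have "vector_space ((*) :: complex \<Rightarrow> complex \<Rightarrow> complex)"
    by unfold_locales (auto simp: algebra_simps)
  then have "Vector_Spaces.linear (*) (smul C) (\<lambda>k. smul C k c)"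
    by (simp add: linear_between_iff C.vector_space_axioms C.scale_left_distrib)
  then have "lam_eval (smul C) (snd (poly_cochain f) a w) x = smul C (lam_eval (*) ?P x) c"
    by (rule lam_eval_hom) (simp add: poly_cochain_def coeff_map_poly)
  also have "lam_eval (*) ?P x = poly ?P x"
    by (simp add: lam_eval_def poly_altdef mult.commute)
  finally show ?thesis by (simp add: poly_pcompose)
qed

text \<open>
  In evaluated coordinates the Jacobi condition is the polynomial cocycle equation for \<open>f\<close> times the
  common factor \<open>p\<^sub>a(-x) p\<^sub>b(-y) q\<^sub>w(\<eta> + x + y)\<close>, where \<open>p\<^sub>a\<close>, \<open>p\<^sub>b\<close>, \<open>q\<^sub>w\<close> are the coordinates of
  \<open>a\<close>, \<open>b\<close>, \<open>w\<close>.
\<close>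

lemma poly_cochain_cocycle:
  assumes "\<And>x y. (\<eta> + \<beta>1 + x + \<alpha>1 * y) * poly f x - (\<eta> + \<beta>1 + y + \<alpha>1 * x) * poly f y
      = (x - y) * poly f (x + y)"
  shows "poly_cochain f \<in> cocycles R C V"
proof -
  have lin: "Vector_Spaces.linear (smul V) (smul C) (\<lambda>w. 0)"
    by (simp add: linear_between_iff V.vector_space_axioms C.vector_space_axioms)
  have bil: "lam_bilinear (smul R) (smul V) (smul C) (snd (poly_cochain f))"
    by (simp add: lam_bilinear_def linear_between_iff R.vector_space_axioms V.vector_space_axioms
        C.vector_space_axioms poly_cochain_def coeff_map_poly A_coord_simps v_coord_simps
        pcompose_add pcompose_smult C.scale_left_distrib ring_distribs)
  have scalar: "poly (A_coord a) (- x) * poly (v_coord (lact V b y w)) (\<eta> + x) * poly f x =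
      poly (A_coord (lbr R a x b)) (- (x + y)) * poly (v_coord w) (\<eta> + (x + y)) * poly f (x + y)
      + poly (A_coord b) (- y) * poly (v_coord (lact V a x w)) (\<eta> + y) * poly f y" (is "?l = ?r")
    for a b w x y
  proof -
    let ?k = "poly (A_coord a) (- x) * poly (A_coord b) (- y) * poly (v_coord w) (\<eta> + x + y)"
    have "?l - ?r = ?k * ((\<eta> + \<beta>1 + x + \<alpha>1 * y) * poly f x - (\<eta> + \<beta>1 + y + \<alpha>1 * x) * poly f y
      - (x - y) * poly f (x + y))"
      by (simp only: v_coord_lact A_coord_lbr) (simp add: algebra_simps)
    then show ?thesis by (simp add: assms)
  qed
  have jacobi: "smul C (poly (A_coord a) (- x) * poly (v_coord (lact V b y w)) (\<eta> + x) * poly f x) c =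
      smul C (poly (A_coord (lbr R a x b)) (- (x + y)) * poly (v_coord w) (\<eta> + (x + y)) * poly f (x + y)) c
      + smul C (poly (A_coord b) (- y) * poly (v_coord (lact V a x w)) (\<eta> + y) * poly f y) c"
    for a b w x y
    unfolding scalar[of a x b y w] C.scale_left_distrib ..
  have der_R: "smul C (poly (A_coord (der R a)) (- x) * poly (v_coord w) (\<eta> + x) * poly f x) c
      = - smul C x (smul C (poly (A_coord a) (- x) * poly (v_coord w) (\<eta> + x) * poly f x) c)"
    for a w x
    by (simp add: A_coord_simps mult.assoc)
  have der_V: "smul C (poly (A_coord a) (- x) * poly (v_coord (der V w)) (\<eta> + x) * poly f x) c
      = smul C \<eta> (smul C (poly (A_coord a) (- x) * poly (v_coord w) (\<eta> + x) * poly f x) c)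
        + smul C x (smul C (poly (A_coord a) (- x) * poly (v_coord w) (\<eta> + x) * poly f x) c)"
    for a w x
    unfolding C.scale_scale C.scale_left_distrib[symmetric]
    by (rule arg_cong[of _ _ "\<lambda>k. smul C k c"]) (simp add: v_coord_simps algebra_simps)
  have fst_0: "fst (poly_cochain f) = (\<lambda>w. 0)"
    by (simp add: poly_cochain_def)
  show ?thesis
    unfolding pair.cocycle_iff eval_poly_cochain lact_C der_C fst_0 add_0_left add_0_right
    by (intro conjI allI lin bil der_R der_V jacobi)
qed

end

section \<open>The exceptional parameters\<close>

context virasoro_first
begin

abbreviation leading :: "complex \<Rightarrow> complex poly" where
  "leading s \<equiv> (if \<alpha>1 = 1 then monom s 2 else monom s 3)"

text \<open>A monomial of degree \<open>2\<close> or \<open>3\<close> is not a coboundary, since the coboundaries have degree at most \<open>1\<close>.\<close>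

lemma leading_independent:
  assumes "smult k [:0, \<alpha>1:] + leading s = smult k' [:0, \<alpha>1:]"
  shows "s = 0"
proof -
  define n :: nat where "n = (if \<alpha>1 = 1 then 2 else 3)"
  have "coeff (leading s) n = s" "coeff (smult k [:0, \<alpha>1:]) n = 0" for k
    by (auto simp: n_def numeral_eq_Suc)
  then show ?thesis using arg_cong[OF assms, of "\<lambda>q. coeff q n"] by (simp del: coeff_smult)
qed

lemma poly_cochain_lift:
  assumes "poly_cochain f \<in> cocycles R C V"
  shows "lift_with (twisted_sum C V (poly_cochain f)) (\<lambda>u. (u, 0)) snd (0, v) f 0"
  unfolding lift_twisted_iff[OF assms] eval_poly_cochain
  by (simp add: A_coord_simps v_coord_simps) (simp add: poly_cochain_def)

context
  assumes critical: "\<alpha>1 \<in> {1, 2}" "\<eta> + \<beta>1 = 0"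
begin

lemma leading_cocycle: "poly_cochain (leading s) \<in> cocycles R C V"
  by (rule poly_cochain_cocycle)
    (use critical in \<open>auto simp: poly_monom algebra_simps power2_eq_square power3_eq_cube\<close>)

lemma critical_classification:
  assumes "extension R C V E i p" "lift_with E i p u f g"
  obtains k s where "g = 0" "f = smult k [:0, \<alpha>1:] + leading s"
  using lift_classification[OF assms] critical by (auto split: if_splits)

lemma critical_trivial_iff:
  assumes "extension R C V E i p" "lift_with E i p u (smult k [:0, \<alpha>1:] + leading s) 0"
  shows "trivial_ext C V E i p \<longleftrightarrow> s = 0"
proof -
  have "trivial_ext C V E i p \<longleftrightarrow> (\<exists>k'. smult k [:0, \<alpha>1:] + leading s = smult k' [:0, \<alpha>1:])"
    unfolding trivial_iff[OF assms] using critical by (simp add: \<delta>)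
  also have "\<dots> \<longleftrightarrow> s = 0"
  proof
    assume "s = 0"
    then have "smult k [:0, \<alpha>1:] + leading s = smult k [:0, \<alpha>1:]" by simp
    then show "\<exists>k'. smult k [:0, \<alpha>1:] + leading s = smult k' [:0, \<alpha>1:]" ..
  qed (blast dest: leading_independent)
  finally show ?thesis .
qed

lemma standard_form_nontrivial:
  assumes ext: "extension R C V E i p" and "s \<noteq> 0"
    and form: "standard_form A B \<delta>1 \<delta>2 \<alpha>1 \<alpha>2 \<beta>1 \<beta>2 \<eta> c v E i p (leading s) 0"
  shows "\<not> trivial_ext C V E i p"
proof -
  interpret virasoro_extension R A B V v C c \<delta>1 \<delta>2 \<alpha>1 \<alpha>2 \<beta>1 \<beta>2 \<eta> E i p
    by unfold_locales (rule ext)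
  obtain u where "lift_with E i p u (leading s) 0" using form standard_form_iff by blast
  then have "lift_with E i p u (smult 0 [:0, \<alpha>1:] + leading s) 0" by simp
  from critical_trivial_iff[OF ext this] \<open>s \<noteq> 0\<close> show ?thesis by blast
qed

lemma standard_extension:
  obtains E :: "('r, 'c \<times> 'v) conf_mod" and i p u
  where "extension R C V E i p" "lift_with E i p u (leading s) 0"
    "standard_form A B \<delta>1 \<delta>2 \<alpha>1 \<alpha>2 \<beta>1 \<beta>2 \<eta> c v E i p (leading s) 0"
proof -
  let ?E = "twisted_sum C V (poly_cochain (leading s))"
  have ext: "extension R C V ?E (\<lambda>u. (u, 0)) snd"
    by (rule pair.twisted_extension[OF leading_cocycle])
  interpret virasoro_extension R A B V v C c \<delta>1 \<delta>2 \<alpha>1 \<alpha>2 \<beta>1 \<beta>2 \<eta> ?E "\<lambda>u. (u, 0)" snd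
    by unfold_locales (rule ext)
  show thesis
    using that[OF ext poly_cochain_lift[OF leading_cocycle]] poly_cochain_lift[OF leading_cocycle]
      standard_form_iff by blast
qed

text \<open>
  A shift of the lift removes the linear term of \<open>f\<close>; what remains is nonzero because \<open>E\<close> does not
  split, and the twisted sum with the same polynomials is equivalent to \<open>E\<close>.
\<close>

lemma nontrivial_normal_form:
  assumes ext: "extension R C V E i p" and nontriv: "\<not> trivial_ext C V E i p"
  shows "\<exists>s (E' :: ('r, 'c \<times> 'v) conf_mod) i' p'. s \<noteq> 0 \<and> extension R C V E' i' p' \<and>
    equivalent_ext E i p E' i' p' \<and>
    standard_form A B \<delta>1 \<delta>2 \<alpha>1 \<alpha>2 \<beta>1 \<beta>2 \<eta> c v E' i' p' (leading s) 0"
proof -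
  interpret virasoro_extension R A B V v C c \<delta>1 \<delta>2 \<alpha>1 \<alpha>2 \<beta>1 \<beta>2 \<eta> E i p
    by unfold_locales (rule ext)
  obtain u where "p u = v" using generator_lifts by blast
  then obtain f g where lift: "lift_with E i p u f g" using lift_exists by blast
  obtain k s where fg: "g = 0" "f = smult k [:0, \<alpha>1:] + leading s"
    by (rule critical_classification[OF ext lift])
  have "s \<noteq> 0" using critical_trivial_iff[OF ext lift[unfolded fg]] nontriv by blast
  have "f - smult k (smult \<delta>1 [:\<eta> + \<beta>1, \<alpha>1:]) = leading s"
    "g - smult k (smult \<delta>2 [:\<eta> + \<beta>2, \<alpha>2:]) = 0"
    using critical by (simp_all add: fg \<delta>)
  with lift_shift[OF lift, of k] have lift': "lift_with E i p (u + smul E k (i c)) (leading s) 0"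
    by simp
  obtain E' :: "('r, 'c \<times> 'v) conf_mod" and i' p' u'
    where E': "extension R C V E' i' p'" "lift_with E' i' p' u' (leading s) 0"
      "standard_form A B \<delta>1 \<delta>2 \<alpha>1 \<alpha>2 \<beta>1 \<beta>2 \<eta> c v E' i' p' (leading s) 0"
    by (rule standard_extension)
  then show ?thesis using lifts_equivalent[OF ext lift' E'(1,2)] \<open>s \<noteq> 0\<close> by blast
qed

text \<open>
  The polynomial of the lift \<open>(0, v)\<close> in the twisted sum depends linearly on the cocycle. Subtracting
  \<open>t\<close> times the basis cocycle therefore lowers the leading coefficient \<open>s\<close> of that polynomial by \<open>t\<close>, and the
  result is trivial exactly for \<open>t = s\<close>.
\<close>

lemma ext_dim_1: "ext_dim R V C 1"
proof -
  define z0 where "z0 = poly_cochain (leading 1)"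
  have z0: "z0 \<in> cocycles R C V" unfolding z0_def by (rule leading_cocycle)
  have lift0: "lift_with (twisted_sum C V z0) (\<lambda>u. (u, 0)) snd (0, v) (leading 1) 0"
    using poly_cochain_lift[OF leading_cocycle] by (simp add: z0_def)
  have "\<exists>s. \<forall>t. z - cochain_scale C t z0 \<in> trivial_cocycles R C V \<longleftrightarrow> t = s"
    if z: "z \<in> cocycles R C V" for z
  proof -
    have ext: "extension R C V (twisted_sum C V z) (\<lambda>u. (u, 0)) snd"
      by (rule pair.twisted_extension[OF z])
    interpret virasoro_extension R A B V v C c \<delta>1 \<delta>2 \<alpha>1 \<alpha>2 \<beta>1 \<beta>2 \<eta>
        "twisted_sum C V z" "\<lambda>u. (u, 0)" snd
      by unfold_locales (rule ext)
    have "snd (0, v) = v" by simp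
    from lift_exists[OF this] obtain f g
      where lift: "lift_with (twisted_sum C V z) (\<lambda>u. (u, 0)) snd (0, v) f g" by blast
    obtain k s where fg: "g = 0" "f = smult k [:0, \<alpha>1:] + leading s"
      by (rule critical_classification[OF ext lift])
    have "z - cochain_scale C t z0 \<in> trivial_cocycles R C V \<longleftrightarrow> t = s" for t
    proof -
      let ?z = "z - cochain_scale C t z0"
      have mem: "?z \<in> cocycles R C V" by (rule pair.cocycle_diff_scale[OF z z0])
      have "lift_with (twisted_sum C V ?z) (\<lambda>u. (u, 0)) snd (0, v) (f - smult t (leading 1)) 0"
        using lift lift0
        unfolding lift_twisted_iff[OF mem] lift_twisted_iff[OF z] lift_twisted_iff[OF z0] fg(1)
        by (simp add: pair.lam_eval_diff pair.cochain_scale_simps C.scale_left_diff_distrib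
            C.scale_right_diff_distrib C.scale_right_distrib C.scale_left_commute
            del: C.scale_eq_0_iff)
      also have "f - smult t (leading 1) = smult k [:0, \<alpha>1:] + leading (s - t)"
        by (simp add: fg smult_monom diff_monom)
      finally have "trivial_ext C V (twisted_sum C V ?z) (\<lambda>u. (u, 0)) snd \<longleftrightarrow> s - t = 0"
        by (rule critical_trivial_iff[OF pair.twisted_extension[OF mem]])
      then show ?thesis using mem by (auto simp: trivial_cocycles_def)
    qed
    then show ?thesis by blast
  qed
  note coefficient = this
  have "ext_basis R V C {z0}"
    unfolding ext_basis_def
  proof (intro conjI ballI)
    fix z assume "z \<in> cocycles R C V"
    then obtain s where s: "\<And>t. z - cochain_scale C t z0 \<in> trivial_cocycles R C V \<longleftrightarrow> t = s"
      using coefficient by blast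
    show "\<exists>!k. (\<forall>s. s \<notin> {z0} \<longrightarrow> k s = 0) \<and>
        z - (\<Sum>s\<in>{z0}. cochain_scale C (k s) s) \<in> trivial_cocycles R C V"
      by (rule ex1I[of _ "\<lambda>y. if y = z0 then s else 0"]) (auto simp: s fun_eq_iff)
  qed (simp_all add: z0)
  then show ?thesis by (auto simp: ext_dim_def)
qed

end

end

section \<open>Exchanging the two Virasoro algebras\<close>

lemma (in virasoro_pair) swap:
  "virasoro_pair R B A V v C c \<delta>2 \<delta>1 \<alpha>2 \<alpha>1 \<beta>2 \<beta>1 \<eta>"
proof
  have "\<exists>!pq. r = pact R (fst pq) B + pact R (snd pq) A" for r
  proof -
    obtain q q' where r: "r = pact R q A + pact R q' B" using R_span by (metis prod.collapse)
    show ?thesis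
    proof (rule ex1I[of _ "(q', q)"])
      show "r = pact R (fst (q', q)) B + pact R (snd (q', q)) A" by (simp add: r)
      fix pq assume "r = pact R (fst pq) B + pact R (snd pq) A"
      then have "r = pact R (fst (prod.swap pq)) A + pact R (snd (prod.swap pq)) B"
        by (simp add: add.commute)
      then have "prod.swap pq = (q, q')" using R_span[of r] r by (metis fst_conv snd_conv)
      then show "pq = (q', q)" by (cases pq) simp
    qed
  qed
  then show "two_virasoro R B A"
    using lie lbr_A_A lbr_B_A lbr_B_B by (simp add: two_virasoro_def)
  show "rank_one_module R B A \<delta>2 \<delta>1 \<alpha>2 \<alpha>1 \<beta>2 \<beta>1 V v"
    using rank_one by (simp add: rank_one_module_def)
qed (rule one_dim)

lemma standard_form_swap:
  "standard_form B A \<delta>2 \<delta>1 \<alpha>2 \<alpha>1 \<beta>2 \<beta>1 \<eta> c v E i p g f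
     = standard_form A B \<delta>1 \<delta>2 \<alpha>1 \<alpha>2 \<beta>1 \<beta>2 \<eta> c v E i p f g"
  unfolding standard_form_def by (rule iff_exI) blast

section \<open>Classification of the extensions\<close>

theorem theorem3p2:
  fixes R :: "('r::ab_group_add) lca" and A B :: 'r
    and V :: "('r, 'v::ab_group_add) conf_mod" and v :: 'v
    and C :: "('r, 'c::ab_group_add) conf_mod" and c :: 'c
    and \<delta>1 \<delta>2 \<alpha>1 \<alpha>2 \<beta>1 \<beta>2 \<eta> :: complex
  assumes "two_virasoro R A B"
    and "\<delta>1 \<in> {0, 1}" and "\<delta>2 \<in> {0, 1}" and "\<delta>1\<^sup>2 + \<delta>2\<^sup>2 = 1"
    and "\<alpha>1 \<noteq> 0" and "\<alpha>2 \<noteq> 0"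
    and "rank_one_module R A B \<delta>1 \<delta>2 \<alpha>1 \<alpha>2 \<beta>1 \<beta>2 V v"
    and "one_dim_module R \<eta> C c"
  shows
    "(\<forall>(E :: ('r, 'e::ab_group_add) conf_mod) i p. extension R C V E i p \<longrightarrow>
        (\<exists>f g. standard_form A B \<delta>1 \<delta>2 \<alpha>1 \<alpha>2 \<beta>1 \<beta>2 \<eta> c v E i p f g))
     \<and> (\<forall>(E :: ('r, 'e) conf_mod) i p.
          extension R C V E i p \<and> \<not> trivial_ext C V E i p \<longrightarrow>
          (\<delta>1 = 1 \<and> \<delta>2 = 0 \<and> \<alpha>1 \<in> {1, 2} \<and> \<beta>1 + \<eta> = 0) \<or>
          (\<delta>1 = 0 \<and> \<delta>2 = 1 \<and> \<alpha>2 \<in> {1, 2} \<and> \<beta>2 + \<eta> = 0))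
     \<and> ((\<delta>1 = 1 \<and> \<delta>2 = 0 \<and> \<alpha>1 \<in> {1, 2} \<and> \<beta>1 + \<eta> = 0) \<or>
          (\<delta>1 = 0 \<and> \<delta>2 = 1 \<and> \<alpha>2 \<in> {1, 2} \<and> \<beta>2 + \<eta> = 0)
          \<longrightarrow> ext_dim R V C 1)
     \<and> (\<delta>1 = 1 \<and> \<alpha>1 \<in> {1, 2} \<and> \<beta>1 + \<eta> = 0 \<longrightarrow>
          \<delta>2 = 0 \<and>
          (\<forall>(E :: ('r, 'e) conf_mod) i p. extension R C V E i p \<and> \<not> trivial_ext C V E i p \<longrightarrow>
             (\<exists>s (E' :: ('r, 'c \<times> 'v) conf_mod) i' p'. s \<noteq> 0 \<and> extension R C V E' i' p' \<and>
                equivalent_ext E i p E' i' p' \<and>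
                standard_form A B \<delta>1 \<delta>2 \<alpha>1 \<alpha>2 \<beta>1 \<beta>2 \<eta> c v E' i' p'
                  (if \<alpha>1 = 1 then monom s 2 else monom s 3) 0)) \<and>
          (\<forall>s. s \<noteq> 0 \<longrightarrow>
             (\<exists>(E :: ('r, 'c \<times> 'v) conf_mod) i p.
                extension R C V E i p \<and> \<not> trivial_ext C V E i p \<and>
                standard_form A B \<delta>1 \<delta>2 \<alpha>1 \<alpha>2 \<beta>1 \<beta>2 \<eta> c v E i p
                  (if \<alpha>1 = 1 then monom s 2 else monom s 3) 0)) \<and>
          (\<forall>s (E :: ('r, 'e) conf_mod) i p. s \<noteq> 0 \<and> extension R C V E i p \<and>
             standard_form A B \<delta>1 \<delta>2 \<alpha>1 \<alpha>2 \<beta>1 \<beta>2 \<eta> c v E i p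
               (if \<alpha>1 = 1 then monom s 2 else monom s 3) 0 \<longrightarrow> \<not> trivial_ext C V E i p))
     \<and> (\<delta>2 = 1 \<and> \<alpha>2 \<in> {1, 2} \<and> \<beta>2 + \<eta> = 0 \<longrightarrow>
          \<delta>1 = 0 \<and>
          (\<forall>(E :: ('r, 'e) conf_mod) i p. extension R C V E i p \<and> \<not> trivial_ext C V E i p \<longrightarrow>
             (\<exists>t (E' :: ('r, 'c \<times> 'v) conf_mod) i' p'. t \<noteq> 0 \<and> extension R C V E' i' p' \<and>
                equivalent_ext E i p E' i' p' \<and>
                standard_form A B \<delta>1 \<delta>2 \<alpha>1 \<alpha>2 \<beta>1 \<beta>2 \<eta> c v E' i' p'
                  0 (if \<alpha>2 = 1 then monom t 2 else monom t 3))) \<and>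
          (\<forall>t. t \<noteq> 0 \<longrightarrow>
             (\<exists>(E :: ('r, 'c \<times> 'v) conf_mod) i p.
                extension R C V E i p \<and> \<not> trivial_ext C V E i p \<and>
                standard_form A B \<delta>1 \<delta>2 \<alpha>1 \<alpha>2 \<beta>1 \<beta>2 \<eta> c v E i p
                  0 (if \<alpha>2 = 1 then monom t 2 else monom t 3))) \<and>
          (\<forall>t (E :: ('r, 'e) conf_mod) i p. t \<noteq> 0 \<and> extension R C V E i p \<and>
             standard_form A B \<delta>1 \<delta>2 \<alpha>1 \<alpha>2 \<beta>1 \<beta>2 \<eta> c v E i p
               0 (if \<alpha>2 = 1 then monom t 2 else monom t 3) \<longrightarrow> \<not> trivial_ext C V E i p))"
proof -
  interpret P: virasoro_pair R A B V v C c \<delta>1 \<delta>2 \<alpha>1 \<alpha>2 \<beta>1 \<beta>2 \<eta>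
    using assms(1,7,8) by unfold_locales
  have form: "\<exists>f g. standard_form A B \<delta>1 \<delta>2 \<alpha>1 \<alpha>2 \<beta>1 \<beta>2 \<eta> c v E i p f g"
    if ext: "extension R C V E i p" for E :: "('r, 'e) conf_mod" and i p
  proof -
    interpret virasoro_extension R A B V v C c \<delta>1 \<delta>2 \<alpha>1 \<alpha>2 \<beta>1 \<beta>2 \<eta> E i p
      by unfold_locales (rule ext)
    obtain u where "p u = v" using generator_lifts by blast
    then show ?thesis using lift_exists standard_form_iff by blast
  qed
  consider (first) "\<delta>1 = 1" "\<delta>2 = 0" | (second) "\<delta>1 = 0" "\<delta>2 = 1"
    using assms(2-4) by auto
  then show ?thesis
  proof cases
    case first
    interpret F: virasoro_first R A B V v C c \<delta>1 \<delta>2 \<alpha>1 \<alpha>2 \<beta>1 \<beta>2 \<eta>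
      by unfold_locales (use first assms(5) in auto)
    have crit: "\<eta> + \<beta>1 = 0" if "\<beta>1 + \<eta> = 0" using that by (simp add: add.commute)
    show ?thesis
    proof (intro conjI impI, goal_cases)
      case 1
      show ?case using form by blast
    next
      case 2
      show ?case using F.nontrivial_parameters first by (auto simp: add.commute)
    next
      case 3
      then show ?case using first crit by (intro F.ext_dim_1) auto
    next
      case 4
      show ?case by (rule first)
    next
      case 5
      then have *: "\<alpha>1 \<in> {1, 2}" "\<eta> + \<beta>1 = 0" using crit by blast+
      show ?case using F.nontrivial_normal_form[OF *] by blast
    next
      case 6
      then have *: "\<alpha>1 \<in> {1, 2}" "\<eta> + \<beta>1 = 0" using crit by blast+
      show ?case
      proof (intro allI impI)
        fix s :: complex assume "s \<noteq> 0"
        obtain E :: "('r, 'c \<times> 'v) conf_mod" and i p u where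
          "extension R C V E i p" "P.lift_with E i p u (F.leading s) 0"
          "standard_form A B \<delta>1 \<delta>2 \<alpha>1 \<alpha>2 \<beta>1 \<beta>2 \<eta> c v E i p (F.leading s) 0"
          by (rule F.standard_extension[OF *])
        then show "\<exists>(E :: ('r, 'c \<times> 'v) conf_mod) i p.
            extension R C V E i p \<and> \<not> trivial_ext C V E i p \<and>
            standard_form A B \<delta>1 \<delta>2 \<alpha>1 \<alpha>2 \<beta>1 \<beta>2 \<eta> c v E i p (F.leading s) 0"
          using F.standard_form_nontrivial[OF *] \<open>s \<noteq> 0\<close> by blast
      qed
    next
      case 7
      then have *: "\<alpha>1 \<in> {1, 2}" "\<eta> + \<beta>1 = 0" using crit by blast+
      show ?case using F.standard_form_nontrivial[OF *] by blast
    qed (use first in simp_all)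
  next
    case second
    interpret F: virasoro_first R B A V v C c \<delta>2 \<delta>1 \<alpha>2 \<alpha>1 \<beta>2 \<beta>1 \<eta>
      using P.swap second assms(6) by (simp add: virasoro_first_def virasoro_first_axioms_def)
    note swap = standard_form_swap[of B A \<delta>2 \<delta>1 \<alpha>2 \<alpha>1 \<beta>2 \<beta>1 \<eta> c v]
    have crit: "\<eta> + \<beta>2 = 0" if "\<beta>2 + \<eta> = 0" using that by (simp add: add.commute)
    show ?thesis
    proof (intro conjI impI, goal_cases)
      case 1
      show ?case using form by blast
    next
      case 2
      show ?case using F.nontrivial_parameters second by (auto simp: add.commute)
    next
      case 3
      then show ?case using second crit by (intro F.ext_dim_1) auto
    next
      case 8
      show ?case by (rule second)
    next
      case 9
      then have *: "\<alpha>2 \<in> {1, 2}" "\<eta> + \<beta>2 = 0" using crit by blast+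
      show ?case using F.nontrivial_normal_form[OF *] unfolding swap by blast
    next
      case 10
      then have *: "\<alpha>2 \<in> {1, 2}" "\<eta> + \<beta>2 = 0" using crit by blast+
      show ?case
      proof (intro allI impI)
        fix t :: complex assume "t \<noteq> 0"
        obtain E :: "('r, 'c \<times> 'v) conf_mod" and i p u where
          "extension R C V E i p" "F.lift_with E i p u (F.leading t) 0"
          "standard_form B A \<delta>2 \<delta>1 \<alpha>2 \<alpha>1 \<beta>2 \<beta>1 \<eta> c v E i p (F.leading t) 0"
          by (rule F.standard_extension[OF *])
        then show "\<exists>(E :: ('r, 'c \<times> 'v) conf_mod) i p.
            extension R C V E i p \<and> \<not> trivial_ext C V E i p \<and>
            standard_form A B \<delta>1 \<delta>2 \<alpha>1 \<alpha>2 \<beta>1 \<beta>2 \<eta> c v E i p 0 (F.leading t)"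
          using F.standard_form_nontrivial[OF *] \<open>t \<noteq> 0\<close> unfolding swap by blast
      qed
    next
      case 11
      then have *: "\<alpha>2 \<in> {1, 2}" "\<eta> + \<beta>2 = 0" using crit by blast+
      show ?case using F.standard_form_nontrivial[OF *] unfolding swap by blast
    qed (use second in simp_all)
  qed
qed

end
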